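(* Let $F: X_h \to \mathbb{R}$ be $\alpha$-strongly convex for some $\alpha>0$ and Fréchet differentiable with $\beta$-Lipschitz continuous derivative for some $\beta>0$, and put $\kappa = \beta/\alpha$. Let $\{W_k\}_{k=1}^N$ be a space decomposition of $Y_h$ which satisfies the stable decomposition assumption with constants $c_1>0$, $c_2\ge 0$. Let $\tau\in(0,1/N]$, let $\mathbf{p}^{(0)}\in C$, and let $\{\mathbf{p}^{(n)}\}_{n\ge 0}$ be generated by the additive Schwarz method. Let $\mathbf{p}^*$ be a solution of $\min_{\mathbf{p}\in C}\mathcal{F}(\mathbf{p})$, and let $\zeta_n = \alpha\left(\mathcal{F}(\mathbf{p}^{(n)})-\mathcal{F}(\mathbf{p}^* )\right)$ for $n\ge 0$. Then, for all $n\ge 0$, $$\zeta_n \le \left(1-\frac{\tau}{\kappa^2\left(\sqrt{c_1}+\sqrt{c_1+\kappa^{-2}}\right)^2}\right)^n\left(\zeta_0-\frac{4c_2|\Omega|}{\kappa\sqrt{c_1(c_1+\kappa^{-2})}}\right)+\frac{4c_2|\Omega|}{\kappa\sqrt{c_1(c_1+\kappa^{-2})}}.$$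
   Context: Discretization. Let $\Omega=(0,m_1h)\times(0,m_2h)\subset\mathbb{R}^2$ be partitioned into $m_1\times m_2$ square elements of side length $h$; $\mathcal{T}_h$ is the collection of elements and $\mathcal{E}_h$ the collection of interior element edges. $X_h$ is the space of functions in $L^2(\Omega)$ that are constant on each $T\in\mathcal{T}_h$; $(u)_T$ denotes the value of $u \in X_h$ on $T$. $Y_h=\{\mathbf{p}\in H_0(\mathrm{div};\Omega): \mathbf{p}|_T\in\mathcal{RT}_0(T)\ \forall T\in\mathcal{T}_h\}$, where $H_0(\mathrm{div};\Omega)$ is the space of $\mathbf{p}\in (L^2(\Omega))^2$ with $\mathrm{div}\,\mathbf{p}\in L^2(\Omega)$ and zero normal component on $\partial\Omega$, and $\mathcal{RT}_0(T)$ is the set of vector fields on $T$ of the form $(x_1,x_2)\mapsto(a_1+b_1x_1,\ a_2+b_2x_2)$. For $\mathbf{p}\in Y_h$ and $e\in\mathcal{E}_h$, $(\mathbf{p})_e=\frac{1}{|e|}\int_e\mathbf{p}\cdot\mathbf{n}_e\,ds$ with $\mathbf{n}_e$ a fixed unit normal to $e$. The inner products are $\langle u,v\rangle_{X_h}=h^2\sum_{T\in\mathcal{T}_h}(u)_T(v)_T$ and $\langle\mathbf{p},\mathbf{q}\rangle_{Y_h}=h^2\sum_{e\in\mathcal{E}_h}(\mathbf{p})_e(\mathbf{q})_e$, with induced norms both written $\|\cdot\|$. The operator $\mathrm{div}$ maps $Y_h$ into $X_h$. Let $C=\{\mathbf{p}\in Y_h: |(\mathbf{p})_e|\le 1\ \forall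 e\in\mathcal{E}_h\}$. Functional. $F$ is $\alpha$-strongly convex if $u\mapsto F(u)-\frac{\alpha}{2}\|u\|^2$ is convex; $F'$ is $\beta$-Lipschitz if $\|F'(u)-F'(v)\|\le\beta\|u-v\|$ for all $u,v\in X_h$. $F^*$ is the Legendre–Fenchel conjugate of $F$ on $X_h$ (with respect to $\langle\cdot,\cdot\rangle_{X_h}$), and $\mathcal{F}(\mathbf{p})=F^*(\mathrm{div}\,\mathbf{p})$ for $\mathbf{p}\in Y_h$. Space decomposition. $W_1,\dots,W_N$ are subspaces of $W=Y_h$ with $W=\sum_{k=1}^N R_k^*W_k$, where $R_k^*:W_k\to W$ is the natural extension operator, adjoint to the restriction operator $R_k:W\to W_k$. Stable decomposition assumption with constants $c_1>0$, $c_2\ge0$: for any $\mathbf{p},\mathbf{q}\in C$ there exist $\mathbf{r}_k\in W_k$ ($k=1,\dots,N$) such that $\mathbf{p}-\mathbf{q}=\sum_{k=1}^N R_k^*\mathbf{r}_k$; $\mathbf{q}+R_k^*\mathbf{r}_k\in C$ for each $k$; and $\sum_{k=1}^N\|\mathrm{div}\,R_k^*\mathbf{r}_k\|^2\le c_1\|\mathrm{div}(\mathbf{p}-\mathbf{q})\|^2+c_2\|\mathbf{p}-\mathbf{q}\|^2$. Additive Schwarz method. Given $\mathbf{p}^{(0)}\in C$ and $\tau\in(0,1/N]$, for $n=0,1,2,\dots$: choose, for each $k=1,\dots,N$, $\mathbf{r}_k^{(n+1)}$ to be a minimizer of $\mathcal{F}(\mathbf{p}^{(n)}+R_k^*\mathbf{r}_k)$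 over all $\mathbf{r}_k\in W_k$ with $\mathbf{p}^{(n)}+R_k^*\mathbf{r}_k\in C$, and set $\mathbf{p}^{(n+1)}=\mathbf{p}^{(n)}+\tau\sum_{k=1}^N R_k^*\mathbf{r}_k^{(n+1)}$. *)

theory Defs
  imports "HOL-Analysis.Analysis" "HOL-Library.Function_Algebras"
begin

(* Pointwise scaling completes the pointwise addition of Function_Algebras to a vector space,
   so that subspace and convex_on apply to spaces of functions. *)
instantiation "fun" :: (type, real_vector) real_vector
begin

definition scaleR_fun :: "real \<Rightarrow> ('a \<Rightarrow> 'b) \<Rightarrow> 'a \<Rightarrow> 'b"
  where "scaleR_fun c f = (\<lambda>x. c *\<^sub>R f x)"

instance
  by standard (auto simp: scaleR_fun_def fun_eq_iff scaleR_add_right scaleR_add_left)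

end

type_synonym point = "real \<times> real"


subsection \<open>The spaces \<open>L\<^sup>2\<close> and \<open>H\<^sub>0(div)\<close>\<close>

definition L2 :: "point set \<Rightarrow> (point \<Rightarrow> 'b::euclidean_space) set"
  where "L2 \<Omega> = {f. set_borel_measurable lebesgue \<Omega> f \<and>
                   set_integrable lebesgue \<Omega> (\<lambda>x. (norm (f x))\<^sup>2)}"

definition C1_with_gradient :: "(point \<Rightarrow> real) \<Rightarrow> (point \<Rightarrow> point) \<Rightarrow> bool"
  where "C1_with_gradient \<phi> g \<longleftrightarrow> (\<forall>x. GDERIV \<phi> x :> g x) \<and> continuous_on UNIV g"

(* Distributional divergence on \<Omega>, tested with C^1 functions of compact support in \<Omega>. *)
definition weak_divergence :: "point set \<Rightarrow> (point \<Rightarrow> point) \<Rightarrow> (point \<Rightarrow> real) \<Rightarrow> bool"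
  where "weak_divergence \<Omega> p d \<longleftrightarrow>
    (\<forall>\<phi> g. C1_with_gradient \<phi> g \<and> (\<exists>K. compact K \<and> K \<subseteq> \<Omega> \<and> (\<forall>x. x \<notin> K \<longrightarrow> \<phi> x = 0)) \<longrightarrow>
       (LINT x:\<Omega>|lebesgue. p x \<bullet> g x) = - (LINT x:\<Omega>|lebesgue. d x * \<phi> x))"

(* The normal component of p on the boundary of \<Omega> is the functional
   \<phi> \<mapsto> \<integral> (p \<bullet> grad \<phi> + (div p) \<phi>) given by Green's formula;
   here \<phi> is not required to vanish near the boundary. *)
definition zero_normal_trace :: "point set \<Rightarrow> (point \<Rightarrow> point) \<Rightarrow> (point \<Rightarrow> real) \<Rightarrow> bool"
  where "zero_normal_trace \<Omega> p d \<longleftrightarrow>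
    (\<forall>\<phi> g. C1_with_gradient \<phi> g \<longrightarrow>
       (LINT x:\<Omega>|lebesgue. p x \<bullet> g x) + (LINT x:\<Omega>|lebesgue. d x * \<phi> x) = 0)"

definition H0_div :: "point set \<Rightarrow> (point \<Rightarrow> point) set"
  where "H0_div \<Omega> = {p \<in> L2 \<Omega>. \<exists>d \<in> L2 \<Omega>. weak_divergence \<Omega> p d \<and> zero_normal_trace \<Omega> p d}"


subsection \<open>Mesh and finite element spaces\<close>

definition Omega :: "nat \<Rightarrow> nat \<Rightarrow> real \<Rightarrow> point set"
  where "Omega m1 m2 h = {0<..<real m1 * h} \<times> {0<..<real m2 * h}"

definition elem :: "real \<Rightarrow> nat \<Rightarrow> nat \<Rightarrow> point set"
  where "elem h i j = {real i * h<..<real (i + 1) * h} \<times> {real j * h<..<real (j + 1) * h}"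

definition Th :: "nat \<Rightarrow> nat \<Rightarrow> real \<Rightarrow> point set set"
  where "Th m1 m2 h = {elem h i j | i j. i < m1 \<and> j < m2}"

(* Elements of L2 are classes modulo null sets. Functions in X_h and Y_h are given by the
   representative that vanishes outside the open elements, so that equality of representatives
   is equality in L2. *)
definition Xh :: "nat \<Rightarrow> nat \<Rightarrow> real \<Rightarrow> (point \<Rightarrow> real) set"
  where "Xh m1 m2 h = {u \<in> L2 (Omega m1 m2 h).
     (\<forall>T \<in> Th m1 m2 h. u constant_on T) \<and> (\<forall>x. x \<notin> \<Union>(Th m1 m2 h) \<longrightarrow> u x = 0)}"

definition elem_val :: "(point \<Rightarrow> real) \<Rightarrow> point set \<Rightarrow> real"
  where "elem_val u T = (THE c. \<forall>x \<in> T. u x = c)"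

definition RT0 :: "point set \<Rightarrow> (point \<Rightarrow> point) set"
  where "RT0 T = {p. \<exists>a1 b1 a2 b2. \<forall>(x1, x2) \<in> T. p (x1, x2) = (a1 + b1 * x1, a2 + b2 * x2)}"

definition Yh :: "nat \<Rightarrow> nat \<Rightarrow> real \<Rightarrow> (point \<Rightarrow> point) set"
  where "Yh m1 m2 h = {p \<in> H0_div (Omega m1 m2 h).
     (\<forall>T \<in> Th m1 m2 h. p \<in> RT0 T) \<and> (\<forall>x. x \<notin> \<Union>(Th m1 m2 h) \<longrightarrow> p x = 0)}"

(* Vert i j is the common edge of elem h i j and elem h (i + 1) j, with normal (1, 0);
   Horiz i j is the common edge of elem h i j and elem h i (j + 1), with normal (0, 1). *)
datatype edge = Vert nat nat | Horiz nat nat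

definition Eh :: "nat \<Rightarrow> nat \<Rightarrow> edge set"
  where "Eh m1 m2 = {Vert i j | i j. i + 1 < m1 \<and> j < m2} \<union> {Horiz i j | i j. i < m1 \<and> j + 1 < m2}"

definition trace_from :: "point set \<Rightarrow> (point \<Rightarrow> point) \<Rightarrow> point \<Rightarrow> point"
  where "trace_from T p x = Lim (at x within T) p"

(* The mean over the edge of the normal component of p. The trace is taken from the left or
   lower element; for p in H(div) the normal traces from both sides agree. *)
fun edge_val :: "real \<Rightarrow> (point \<Rightarrow> point) \<Rightarrow> edge \<Rightarrow> real"
  where
    "edge_val h p (Vert i j) = 1 / h *
       integral {real j * h..real (j + 1) * h}
         (\<lambda>s. trace_from (elem h i j) p (real (i + 1) * h, s) \<bullet> (1, 0))"
  | "edge_val h p (Horiz i j) = 1 / h *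
       integral {real i * h..real (i + 1) * h}
         (\<lambda>s. trace_from (elem h i j) p (s, real (j + 1) * h) \<bullet> (0, 1))"

definition inner_X :: "nat \<Rightarrow> nat \<Rightarrow> real \<Rightarrow> (point \<Rightarrow> real) \<Rightarrow> (point \<Rightarrow> real) \<Rightarrow> real"
  where "inner_X m1 m2 h u v = h\<^sup>2 * (\<Sum>T \<in> Th m1 m2 h. elem_val u T * elem_val v T)"

definition norm_X :: "nat \<Rightarrow> nat \<Rightarrow> real \<Rightarrow> (point \<Rightarrow> real) \<Rightarrow> real"
  where "norm_X m1 m2 h u = sqrt (inner_X m1 m2 h u u)"

definition inner_Y :: "nat \<Rightarrow> nat \<Rightarrow> real \<Rightarrow> (point \<Rightarrow> point) \<Rightarrow> (point \<Rightarrow> point) \<Rightarrow> real"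
  where "inner_Y m1 m2 h p q = h\<^sup>2 * (\<Sum>e \<in> Eh m1 m2. edge_val h p e * edge_val h q e)"

definition norm_Y :: "nat \<Rightarrow> nat \<Rightarrow> real \<Rightarrow> (point \<Rightarrow> point) \<Rightarrow> real"
  where "norm_Y m1 m2 h p = sqrt (inner_Y m1 m2 h p p)"

definition div_h :: "nat \<Rightarrow> nat \<Rightarrow> real \<Rightarrow> (point \<Rightarrow> point) \<Rightarrow> (point \<Rightarrow> real)"
  where "div_h m1 m2 h p = (THE d. d \<in> Xh m1 m2 h \<and> weak_divergence (Omega m1 m2 h) p d)"

definition Cset :: "nat \<Rightarrow> nat \<Rightarrow> real \<Rightarrow> (point \<Rightarrow> point) set"
  where "Cset m1 m2 h = {p \<in> Yh m1 m2 h. \<forall>e \<in> Eh m1 m2. \<bar>edge_val h p e\<bar> \<le> 1}"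


subsection \<open>Functionals on \<open>X\<^sub>h\<close>\<close>

(* A functional on X_h is a function on all of point \<Rightarrow> real of which only the values on X_h
   are used. *)

definition strongly_convex_X ::
    "nat \<Rightarrow> nat \<Rightarrow> real \<Rightarrow> real \<Rightarrow> ((point \<Rightarrow> real) \<Rightarrow> real) \<Rightarrow> bool"
  where "strongly_convex_X m1 m2 h \<alpha> F \<longleftrightarrow>
    convex_on (Xh m1 m2 h) (\<lambda>u. F u - \<alpha> / 2 * (norm_X m1 m2 h u)\<^sup>2)"

(* g is the Frechet derivative of F at u, identified with an element of X_h via inner_X. *)
definition frechet_derivative_X ::
    "nat \<Rightarrow> nat \<Rightarrow> real \<Rightarrow> ((point \<Rightarrow> real) \<Rightarrow> real) \<Rightarrow> (point \<Rightarrow> real) \<Rightarrow> (point \<Rightarrow> real) \<Rightarrow> bool"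
  where "frechet_derivative_X m1 m2 h F u g \<longleftrightarrow> g \<in> Xh m1 m2 h \<and>
    (\<forall>\<epsilon>>0. \<exists>\<delta>>0. \<forall>v \<in> Xh m1 m2 h. norm_X m1 m2 h (v - u) < \<delta> \<longrightarrow>
       \<bar>F v - F u - inner_X m1 m2 h g (v - u)\<bar> \<le> \<epsilon> * norm_X m1 m2 h (v - u))"

(* Real-valued supremum: for strongly convex F the set is bounded above. *)
definition conjugate_X ::
    "nat \<Rightarrow> nat \<Rightarrow> real \<Rightarrow> ((point \<Rightarrow> real) \<Rightarrow> real) \<Rightarrow> (point \<Rightarrow> real) \<Rightarrow> real"
  where "conjugate_X m1 m2 h F v = (SUP u \<in> Xh m1 m2 h. inner_X m1 m2 h u v - F u)"

definition dual_energy ::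
    "nat \<Rightarrow> nat \<Rightarrow> real \<Rightarrow> ((point \<Rightarrow> real) \<Rightarrow> real) \<Rightarrow> (point \<Rightarrow> point) \<Rightarrow> real"
  where "dual_energy m1 m2 h F p = conjugate_X m1 m2 h F (div_h m1 m2 h p)"


subsection \<open>Additive Schwarz method\<close>

(* As the local spaces are subspaces of Y_h, the natural extension operators are the inclusions
   and are not written. *)

definition space_decomposition ::
    "nat \<Rightarrow> nat \<Rightarrow> real \<Rightarrow> nat \<Rightarrow> (nat \<Rightarrow> (point \<Rightarrow> point) set) \<Rightarrow> bool"
  where "space_decomposition m1 m2 h N W \<longleftrightarrow>
    (\<forall>k \<in> {1..N}. subspace (W k) \<and> W k \<subseteq> Yh m1 m2 h) \<and>
    Yh m1 m2 h = {\<Sum>k=1..N. r k | r. \<forall>k \<in> {1..N}. r k \<in> W k}"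

definition stable_decomposition ::
    "nat \<Rightarrow> nat \<Rightarrow> real \<Rightarrow> nat \<Rightarrow> (nat \<Rightarrow> (point \<Rightarrow> point) set) \<Rightarrow> real \<Rightarrow> real \<Rightarrow> bool"
  where "stable_decomposition m1 m2 h N W c1 c2 \<longleftrightarrow>
    (\<forall>p \<in> Cset m1 m2 h. \<forall>q \<in> Cset m1 m2 h. \<exists>r.
       (\<forall>k \<in> {1..N}. r k \<in> W k) \<and>
       p - q = (\<Sum>k=1..N. r k) \<and>
       (\<forall>k \<in> {1..N}. q + r k \<in> Cset m1 m2 h) \<and>
       (\<Sum>k=1..N. (norm_X m1 m2 h (div_h m1 m2 h (r k)))\<^sup>2)
         \<le> c1 * (norm_X m1 m2 h (div_h m1 m2 h (p - q)))\<^sup>2 + c2 * (norm_Y m1 m2 h (p - q))\<^sup>2)"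

definition additive_schwarz ::
    "nat \<Rightarrow> nat \<Rightarrow> real \<Rightarrow> ((point \<Rightarrow> real) \<Rightarrow> real) \<Rightarrow> nat \<Rightarrow> (nat \<Rightarrow> (point \<Rightarrow> point) set) \<Rightarrow>
     real \<Rightarrow> (nat \<Rightarrow> point \<Rightarrow> point) \<Rightarrow> bool"
  where "additive_schwarz m1 m2 h F N W \<tau> p \<longleftrightarrow>
    (\<forall>n. \<exists>r.
       (\<forall>k \<in> {1..N}. is_arg_min (\<lambda>s. dual_energy m1 m2 h F (p n + s))
                       (\<lambda>s. s \<in> W k \<and> p n + s \<in> Cset m1 m2 h) (r k)) \<and>
       p (Suc n) = p n + \<tau> *\<^sub>R (\<Sum>k=1..N. r k))"

end

theory Submission
  imports Defs
begin

text \<open>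
  Write \<open>F\<^sup>*\<close> for the conjugate of \<open>F\<close>, \<open>v = div p\<^sup>(\<^sup>n\<^sup>)\<close> and \<open>w = div p\<^sup>*\<close>. The conjugate is \<open>1/\<beta>\<close>-strongly
  convex and \<open>1/\<alpha>\<close>-smooth. Testing the local minimality of each correction against \<open>s r\<^sub>k\<close>, where
  \<open>p\<^sup>* - p\<^sup>(\<^sup>n\<^sup>) = \<Sum> r\<^sub>k\<close> is the stable decomposition, and using convexity for the relaxed update gives
  \<open>\<zeta>\<^sub>n\<^sub>+\<^sub>1 \<le> (1 - \<tau>s) \<zeta>\<^sub>n + \<tau>s/2 (s c\<^sub>1 - 1/\<kappa>) \<parallel>w - v\<parallel>\<^sup>2 + 4 \<tau> s\<^sup>2 c\<^sub>2 |\<Omega>|\<close>.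
  The choice \<open>s = 1 / (\<kappa>\<^sup>2 (\<surd>c\<^sub>1 + \<surd>(c\<^sub>1 + \<kappa>\<^sup>-\<^sup>2))\<^sup>2)\<close> makes the middle term nonpositive, and
  \<open>s \<le> 1 / (\<kappa> \<surd>(c\<^sub>1 (c\<^sub>1 + \<kappa>\<^sup>-\<^sup>2)))\<close>; both inequalities use \<open>\<kappa> \<ge> 1\<close>.
\<close>

subsection \<open>Conjugates of smooth strongly convex functions\<close>

text \<open>The estimates treat \<open>div_h\<close> as a linear map from \<open>Yh\<close> to
  \<open>Xh\<close>, and proving this is the main obstacle: membership in \<open>H0_div\<close> only
  provides some square integrable weak divergence. It is identified with the elementwise constant
  one by testing with functions multiplied by a cutoff that vanishes on the grid lines, so
  continuity of normal components across edges never has to be computed. The convex analysis is done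
  for an abstract semidefinite form, because the form used for \<open>Xh\<close> lives on a whole
  function type, where it degenerates. The two properties of the conjugate appear there as quadratic
  bounds attached to a primal point \<open>u\<close>, without a derivative of the conjugate. The
  constant 4 is counted on the mesh: the squared distance of two members of \<open>Cset\<close> is
  at most 8 |Omega|, and the quadratic upper bound of the conjugate contributes a factor 1/2. The
  inequality \<kappa> \<ge> 1 results from comparing the lower and upper quadratic bounds on
  \<open>F\<close> at the indicator of one element.\<close>

locale semi_inner =
  fixes ip :: "'a::real_vector \<Rightarrow> 'a \<Rightarrow> real"
  assumes bilinear_ip: "bilinear ip"
    and ip_commute: "ip u v = ip v u"
    and ip_nonneg: "ip u u \<ge> 0"
begin

definition nrm :: "'a \<Rightarrow> real"
  where "nrm u = sqrt (ip u u)"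

lemmas ip_simps =
  bilinear_ladd[OF bilinear_ip] bilinear_radd[OF bilinear_ip]
  bilinear_lsub[OF bilinear_ip] bilinear_rsub[OF bilinear_ip]
  bilinear_lmul[OF bilinear_ip] bilinear_rmul[OF bilinear_ip]
  bilinear_lzero[OF bilinear_ip] bilinear_rzero[OF bilinear_ip]
  bilinear_lneg[OF bilinear_ip] bilinear_rneg[OF bilinear_ip]

lemma ip_sum_right: "ip u (\<Sum>k\<in>A. f k) = (\<Sum>k\<in>A. ip u (f k))"
  by (induction A rule: infinite_finite_induct) (simp_all add: ip_simps)

lemma nrm_nonneg [simp]: "nrm u \<ge> 0"
  by (simp add: nrm_def ip_nonneg)

lemma nrm_sq: "(nrm u)\<^sup>2 = ip u u"
  by (simp add: nrm_def ip_nonneg)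

lemma nrm_scale: "nrm (c *\<^sub>R u) = \<bar>c\<bar> * nrm u"
  by (simp add: nrm_def ip_simps real_sqrt_mult flip: mult.assoc)

lemma nrm_add_sq: "(nrm (u + v))\<^sup>2 = (nrm u)\<^sup>2 + 2 * ip u v + (nrm v)\<^sup>2"
  by (simp add: nrm_sq ip_simps ip_commute[of v u])

text \<open>The form is only semidefinite, so \<open>ip v v = 0\<close> does not give
  \<open>v = 0\<close> and is a separate case. There \<open>ip\<close> of
  \<open>u + t *\<^sub>R v\<close> with itself is affine in \<open>t\<close>, and it can stay
  nonnegative only with slope 0.\<close>

lemma Cauchy_Schwarz_ip: "\<bar>ip u v\<bar> \<le> nrm u * nrm v"
proof -
  have "(ip u v)\<^sup>2 \<le> ip u u * ip v v"
  proof (cases "ip v v = 0")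
    case True
    have "ip u v = 0"
    proof (rule ccontr)
      assume nz: "ip u v \<noteq> 0"
      \<comment> \<open>The point where the affine function of \<open>t\<close> takes the value
        -1.\<close>
      define t where "t = - (ip u u + 1) / (2 * ip u v)"
      have "0 \<le> ip (u + t *\<^sub>R v) (u + t *\<^sub>R v)"
        by (rule ip_nonneg)
      also have "\<dots> = ip u u + 2 * t * ip u v"
        using True by (simp add: ip_simps ip_commute[of v u])
      also have "\<dots> = -1"
        using nz by (simp add: t_def field_simps)
      finally show False by simp
    qed
    then show ?thesis
      by (simp add: True)
  next
    case False
    then have pos: "ip v v > 0"
      using ip_nonneg[of v] by simp
    \<comment> \<open>The minimizer of the quadratic in \<open>t\<close>.\<close>
    define t where "t = - ip u v / ip v v"
    have "0 \<le> ip (u + t *\<^sub>R v) (u + t *\<^sub>R v)"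
      by (rule ip_nonneg)
    also have "\<dots> = ip u u - (ip u v)\<^sup>2 / ip v v"
      using pos by (simp add: ip_simps ip_commute[of v u] t_def field_simps power2_eq_square)
    finally show ?thesis
      using pos by (simp add: field_simps)
  qed
  then have "sqrt ((ip u v)\<^sup>2) \<le> sqrt (ip u u * ip v v)"
    by (rule real_sqrt_le_mono)
  then show ?thesis
    by (simp add: nrm_def real_sqrt_mult)
qed

end

text \<open>\<open>F\<close> may be arbitrary outside \<open>X\<close>, so convexity and
  differentiability are only tested inside \<open>X\<close>. \<open>F'_mem\<close> makes gradient
  steps stay in \<open>X\<close>, which \<open>conjugate_strong_ge\<close> relies on.\<close>

locale smooth_strongly_convex = semi_inner ip
  for ip :: "'a::real_vector \<Rightarrow> 'a \<Rightarrow> real" +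
  fixes X :: "'a set" and F :: "'a \<Rightarrow> real" and F' :: "'a \<Rightarrow> 'a" and \<alpha> \<beta> :: real
  assumes X: "subspace X"
    and \<alpha>: "\<alpha> > 0" and \<beta>: "\<beta> > 0"
    and strongly_convex: "convex_on X (\<lambda>u. F u - \<alpha> / 2 * (nrm u)\<^sup>2)"
    and F'_mem: "u \<in> X \<Longrightarrow> F' u \<in> X"
    and F'_frechet: "u \<in> X \<Longrightarrow> \<epsilon> > 0 \<Longrightarrow> \<exists>\<delta>>0. \<forall>v\<in>X. nrm (v - u) < \<delta> \<longrightarrow>
        \<bar>F v - F u - ip (F' u) (v - u)\<bar> \<le> \<epsilon> * nrm (v - u)"
    and F'_lipschitz: "u \<in> X \<Longrightarrow> v \<in> X \<Longrightarrow> nrm (F' u - F' v) \<le> \<beta> * nrm (u - v)"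
begin

lemma X_closed:
  "u \<in> X \<Longrightarrow> v \<in> X \<Longrightarrow> u + v \<in> X" "u \<in> X \<Longrightarrow> v \<in> X \<Longrightarrow> u - v \<in> X"
  "u \<in> X \<Longrightarrow> c *\<^sub>R u \<in> X"
  using X by (auto simp: subspace_add subspace_diff subspace_scale)

lemma F_line_deriv:
  assumes u: "u \<in> X" and d: "d \<in> X"
  shows "((\<lambda>t. F (u + t *\<^sub>R d)) has_real_derivative ip (F' (u + t *\<^sub>R d)) d) (at t)"
  unfolding has_field_derivative_def has_derivative_at_alt
proof (intro conjI allI impI)
  show "bounded_linear ((*) (ip (F' (u + t *\<^sub>R d)) d))"
    by (rule bounded_linear_mult_right)
next
  fix e :: real
  assume e: "e > 0"
  let ?w = "u + t *\<^sub>R d"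
  have w: "?w \<in> X"
    using u d by (simp add: X_closed)
  \<comment> \<open>\<open>nrm d\<close> may vanish, so tolerances are divided by
    \<open>nrm d + 1\<close>.\<close>
  have n: "nrm d + 1 > 0"
    using nrm_nonneg[of d] by linarith
  with e have "e / (nrm d + 1) > 0" by simp
  from F'_frechet[OF w this] obtain \<delta> where \<delta>: "\<delta> > 0"
    and D: "\<And>v. v \<in> X \<Longrightarrow> nrm (v - ?w) < \<delta> \<Longrightarrow>
        \<bar>F v - F ?w - ip (F' ?w) (v - ?w)\<bar> \<le> e / (nrm d + 1) * nrm (v - ?w)"
    by blast
  show "\<exists>\<delta>>0. \<forall>y. norm (y - t) < \<delta> \<longrightarrow>
      norm (F (u + y *\<^sub>R d) - F ?w - ip (F' ?w) d * (y - t)) \<le> e * norm (y - t)"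
  proof (intro exI conjI allI impI)
    show "\<delta> / (nrm d + 1) > 0"
      using \<delta> n by simp
    fix y assume y: "norm (y - t) < \<delta> / (nrm d + 1)"
    have diff: "u + y *\<^sub>R d - ?w = (y - t) *\<^sub>R d"
      by (simp add: algebra_simps)
    have nd: "nrm (u + y *\<^sub>R d - ?w) = \<bar>y - t\<bar> * nrm d"
      unfolding diff by (rule nrm_scale)
    have "\<bar>y - t\<bar> * nrm d \<le> \<bar>y - t\<bar> * (nrm d + 1)"
      by (intro mult_left_mono) auto
    also have "\<dots> < \<delta>"
      using y n by (simp add: field_simps)
    finally have "\<bar>F (u + y *\<^sub>R d) - F ?w - ip (F' ?w) (u + y *\<^sub>R d - ?w)\<bar>
        \<le> e / (nrm d + 1) * nrm (u + y *\<^sub>R d - ?w)"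
      using u d nd by (intro D) (simp_all add: X_closed)
    also have "\<dots> = e * \<bar>y - t\<bar> * (nrm d / (nrm d + 1))"
      unfolding nd by simp
    also have "\<dots> \<le> e * \<bar>y - t\<bar> * 1"
      using e n by (intro mult_left_mono) (auto simp: field_simps)
    finally show "norm (F (u + y *\<^sub>R d) - F ?w - ip (F' ?w) d * (y - t)) \<le> e * norm (y - t)"
      unfolding diff by (simp add: ip_simps mult.commute)
  qed
qed

text \<open>As \<open>X\<close> is a subspace, it contains the whole line through \<open>u\<close>
  and \<open>w\<close>. On it \<open>F\<close> minus the quadratic is a convex function of one real
  variable and lies above its tangent at 0. Expanding the quadratic exactly restores the subtracted
  terms.\<close>

lemma F_lower:
  assumes u: "u \<in> X" and w: "w \<in> X"
  shows "F u + ip (F' u) (w - u) + \<alpha> / 2 * (nrm (w - u))\<^sup>2 \<le> F w"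
proof -
  define d where "d = w - u"
  have d: "d \<in> X"
    using u w by (simp add: d_def X_closed)
  define \<psi> where "\<psi> t = F (u + t *\<^sub>R d) - \<alpha> / 2 * (nrm (u + t *\<^sub>R d))\<^sup>2" for t
  have nsq: "(nrm (u + t *\<^sub>R d))\<^sup>2 = (nrm u)\<^sup>2 + 2 * t * ip u d + t\<^sup>2 * (nrm d)\<^sup>2" for t
    by (simp add: nrm_add_sq nrm_scale ip_simps power_mult_distrib)
  have "convex_on UNIV \<psi>"
  proof (rule convex_onI)
    fix t x y :: real
    assume t: "0 < t" "t < 1"
    have eq: "u + ((1 - t) *\<^sub>R x + t *\<^sub>R y) *\<^sub>R d
        = (1 - t) *\<^sub>R (u + x *\<^sub>R d) + t *\<^sub>R (u + y *\<^sub>R d)"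
      by (simp add: algebra_simps)
    show "\<psi> ((1 - t) *\<^sub>R x + t *\<^sub>R y) \<le> (1 - t) * \<psi> x + t * \<psi> y"
      unfolding \<psi>_def eq
      using convex_onD[OF strongly_convex, of t "u + x *\<^sub>R d" "u + y *\<^sub>R d"] t u d
      by (simp add: X_closed)
  qed auto
  moreover have "(\<psi> has_real_derivative ip (F' (u + 0 *\<^sub>R d)) d - \<alpha> * ip u d) (at 0)"
    unfolding \<psi>_def nsq
    by (rule F_line_deriv[OF u d, of 0] derivative_eq_intros | simp)+
  ultimately have "\<psi> 1 - \<psi> 0 \<ge> (ip (F' (u + 0 *\<^sub>R d)) d - \<alpha> * ip u d) * (1 - 0)"
    by (intro convex_on_imp_above_tangent[where A = UNIV]) auto
  then show ?thesis
    unfolding \<psi>_def nsq by (simp add: d_def field_simps)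
qed

text \<open>The descent lemma without integrating the gradient: \<open>F\<close> minus the claimed
  bound, restricted to the segment, has a nonpositive derivative by Cauchy-Schwarz and the Lipschitz
  condition.\<close>

lemma F_upper:
  assumes u: "u \<in> X" and w: "w \<in> X"
  shows "F w \<le> F u + ip (F' u) (w - u) + \<beta> / 2 * (nrm (w - u))\<^sup>2"
proof -
  define d where "d = w - u"
  have d: "d \<in> X"
    using u w by (simp add: d_def X_closed)
  define \<phi> where "\<phi> t = F (u + t *\<^sub>R d) - t * ip (F' u) d - \<beta> / 2 * t\<^sup>2 * (nrm d)\<^sup>2" for t
  have "\<phi> 1 \<le> \<phi> 0"
  proof (rule DERIV_nonpos_imp_nonincreasing[of 0 1 \<phi>])
    fix t :: real
    assume t: "0 \<le> t"
    have "((\<lambda>t. t * ip (F' u) d) has_real_derivative ip (F' u) d) (at t)"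
      by (rule derivative_eq_intros refl | simp)+
    moreover have "((\<lambda>t. \<beta> / 2 * t\<^sup>2 * (nrm d)\<^sup>2) has_real_derivative \<beta> * t * (nrm d)\<^sup>2) (at t)"
      by (rule derivative_eq_intros refl | simp)+
    ultimately have "(\<phi> has_real_derivative
        ip (F' (u + t *\<^sub>R d)) d - ip (F' u) d - \<beta> * t * (nrm d)\<^sup>2) (at t)"
      unfolding \<phi>_def using F_line_deriv[OF u d, of t] by (intro DERIV_diff)
    moreover have "ip (F' (u + t *\<^sub>R d)) d - ip (F' u) d \<le> \<beta> * t * (nrm d)\<^sup>2"
    proof -
      have "ip (F' (u + t *\<^sub>R d) - F' u) d \<le> nrm (F' (u + t *\<^sub>R d) - F' u) * nrm d"
        using Cauchy_Schwarz_ip abs_le_D1 by blast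
      also have "\<dots> \<le> \<beta> * nrm (u + t *\<^sub>R d - u) * nrm d"
        using u d by (intro mult_right_mono F'_lipschitz) (auto simp: X_closed)
      finally show ?thesis
        using t by (simp add: nrm_scale ip_simps power2_eq_square)
    qed
    ultimately show "\<exists>y. (\<phi> has_real_derivative y) (at t) \<and> y \<le> 0"
      by (intro exI conjI) auto
  qed simp
  then show ?thesis
    by (simp add: \<phi>_def d_def)
qed

text \<open>The two quadratic bounds at 0 have the same affine part, so a single vector of positive
  norm orders their coefficients.\<close>

lemma alpha_le_beta:
  assumes u: "u \<in> X" and "nrm u > 0"
  shows "\<alpha> \<le> \<beta>"
proof -
  have 0: "0 \<in> X"
    using X by (rule subspace_0)
  have "\<alpha> / 2 * (nrm u)\<^sup>2 \<le> \<beta> / 2 * (nrm u)\<^sup>2"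
    using F_lower[OF 0 u] F_upper[OF 0 u] by simp
  with \<open>nrm u > 0\<close> show ?thesis
    by simp
qed

definition conjugate :: "'a \<Rightarrow> real"
  where "conjugate v = (SUP u\<in>X. ip u v - F u)"

lemma young:
  assumes "c > 0"
  shows "ip u v \<le> c / 2 * (nrm u)\<^sup>2 + (nrm v)\<^sup>2 / (2 * c)"
proof -
  have "0 \<le> (nrm (c *\<^sub>R u - v))\<^sup>2"
    by simp
  also have "\<dots> = c\<^sup>2 * (nrm u)\<^sup>2 - 2 * c * ip u v + (nrm v)\<^sup>2"
    unfolding nrm_sq by (simp add: ip_simps ip_commute[of v u] power2_eq_square algebra_simps)
  finally show ?thesis
    using assms by (simp add: field_simps power2_eq_square)
qed

text \<open>Strong convexity leaves the pairing of \<open>w - u\<close> with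
  \<open>v - F' u\<close>. Young's inequality with constant \<alpha> absorbs it into the quadratic
  term, so the bound is uniform in \<open>w\<close>.\<close>

lemma conjugate_quad_upper:
  assumes u: "u \<in> X" and w: "w \<in> X"
  shows "ip w v - F w \<le> ip u v - F u + (nrm (v - F' u))\<^sup>2 / (2 * \<alpha>)"
  using F_lower[OF u w] young[OF \<alpha>, of "w - u" "v - F' u"]
  by (simp add: ip_simps ip_commute[of w] ip_commute[of u])

text \<open>The form in which smoothness of the conjugate is used: if \<open>F' u\<close> equals
  some \<open>v0\<close>, this is the quadratic upper bound around \<open>v0\<close> with slope
  \<open>u\<close>. Its counterpart \<open>conjugate_strong_ge\<close> plays the role of strong
  convexity.\<close>

lemma conjugate_le:
  assumes "u \<in> X"
  shows "conjugate v \<le> ip u v - F u + (nrm (v - F' u))\<^sup>2 / (2 * \<alpha>)"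
  unfolding conjugate_def using assms X by (intro cSUP_least conjugate_quad_upper) (auto dest: subspace_0)

lemma conjugate_ge:
  assumes "u \<in> X"
  shows "ip u v - F u \<le> conjugate v"
proof -
  have "bdd_above ((\<lambda>u. ip u v - F u) ` X)"
    using conjugate_quad_upper[OF assms, of _ v] by (intro bdd_aboveI2)
  then show ?thesis
    unfolding conjugate_def using assms by (intro cSUP_upper)
qed

text \<open>Instead of \<open>u\<close> itself, the gradient step of length 1/\<beta> from
  \<open>u\<close> is inserted into the supremum. The descent lemma then costs half of what the
  pairing with \<open>v - F' u\<close> gains.\<close>

lemma conjugate_strong_ge:
  assumes u: "u \<in> X" and v: "v \<in> X"
  shows "ip u v - F u + (nrm (v - F' u))\<^sup>2 / (2 * \<beta>) \<le> conjugate v"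
proof -
  define t where "t = (1 / \<beta>) *\<^sub>R (v - F' u)"
  have t: "t \<in> X" "u + t \<in> X"
    using u v by (auto simp: t_def X_closed F'_mem)
  have "F (u + t) \<le> F u + ip (F' u) t + \<beta> / 2 * (nrm t)\<^sup>2"
    using F_upper[OF u t(2)] by simp
  moreover have "\<beta> / 2 * (nrm t)\<^sup>2 = (nrm (v - F' u))\<^sup>2 / (2 * \<beta>)"
    unfolding t_def nrm_scale using \<beta> by (simp add: power_mult_distrib power2_eq_square)
  moreover have "ip t (v - F' u) = 2 * ((nrm (v - F' u))\<^sup>2 / (2 * \<beta>))"
    using \<beta> by (simp add: t_def ip_simps(5) nrm_sq)
  ultimately show ?thesis
    using conjugate_ge[OF t(2), of v] by (simp add: ip_simps ip_commute)
qed

text \<open>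
  Near-maximizers replace the maximizer \<open>u\<close> with \<open>F' u = v\<close>, so that no compactness of \<open>X\<close> is needed;
  the error \<open>\<delta>\<close> is sent to 0 in the next lemma.
\<close>

lemma conjugate_near_maximizer:
  assumes v: "v \<in> X" and "\<delta> > 0"
  obtains u where "u \<in> X" "conjugate v - \<delta>\<^sup>2 / (2 * \<beta>) \<le> ip u v - F u" "nrm (v - F' u) \<le> \<delta>"
proof -
  \<comment> \<open>The gap is matched to \<open>conjugate_strong_ge\<close>: a point whose value is
    this close to the supremum has \<open>nrm (v - F' u)\<close> at most \<delta>.\<close>
  have less: "conjugate v - \<delta>\<^sup>2 / (2 * \<beta>) < conjugate v"
    using \<open>\<delta> > 0\<close> \<beta> by simp
  have "\<exists>u\<in>X. conjugate v - \<delta>\<^sup>2 / (2 * \<beta>) < ip u v - F u"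
  proof (rule ccontr)
    assume "\<not> ?thesis"
    then have "conjugate v \<le> conjugate v - \<delta>\<^sup>2 / (2 * \<beta>)"
      using v by (subst conjugate_def, intro cSUP_least) (auto simp: not_less)
    with less show False by simp
  qed
  then obtain u where u: "u \<in> X" "conjugate v - \<delta>\<^sup>2 / (2 * \<beta>) < ip u v - F u"
    by blast
  have "(nrm (v - F' u))\<^sup>2 / (2 * \<beta>) \<le> \<delta>\<^sup>2 / (2 * \<beta>)"
    using u conjugate_strong_ge[OF u(1) v] by simp
  then have "(nrm (v - F' u))\<^sup>2 \<le> \<delta>\<^sup>2"
    using \<beta> by (simp add: divide_le_cancel)
  then show thesis
    using that u \<open>\<delta> > 0\<close> by (simp add: power2_le_iff_abs_le)
qed

text \<open>One common near-maximizer \<open>u\<close> serves all terms: \<open>conjugate_le\<close>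
  bounds the shifted values from above and \<open>conjugate_strong_ge\<close> bounds the value at
  \<open>w\<close> from below. The slopes \<open>ip u (d k)\<close> add up to
  \<open>ip u (w - v)\<close> because the \<open>d k\<close> sum to \<open>w - v\<close>.\<close>

lemma conjugate_local_sum:
  assumes v: "v \<in> X" and w: "w \<in> X" and K: "finite K"
    and d: "\<And>k. k \<in> K \<Longrightarrow> d k \<in> X" and sum_d: "(\<Sum>k\<in>K. d k) = w - v" and s: "s \<ge> 0"
  shows "(\<Sum>k\<in>K. conjugate (v + s *\<^sub>R d k) - conjugate v)
    \<le> s * (conjugate w - conjugate v) - s / (2 * \<beta>) * (nrm (w - v))\<^sup>2 + s\<^sup>2 / (2 * \<alpha>) * (\<Sum>k\<in>K. (nrm (d k))\<^sup>2)"
    (is "?L \<le> ?R")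
proof -
  \<comment> \<open>\<open>B\<close> is a polynomial in \<delta> with \<open>B 0 = ?R\<close>; its
    remaining terms bound the contributions of the residual \<open>v - F' u\<close> and of the gap
    to the supremum.\<close>
  define B where "B \<delta> = s * (conjugate w - conjugate v + \<delta>\<^sup>2 / (2 * \<beta>)
      - ((nrm (w - v))\<^sup>2 - 2 * \<delta> * nrm (w - v)) / (2 * \<beta>))
      + (\<Sum>k\<in>K. (\<delta>\<^sup>2 + 2 * \<delta> * s * nrm (d k) + s\<^sup>2 * (nrm (d k))\<^sup>2) / (2 * \<alpha>))" for \<delta>
  have "?L \<le> B \<delta>" if "\<delta> > 0" for \<delta>
  proof -
    obtain u where u: "u \<in> X" "conjugate v - \<delta>\<^sup>2 / (2 * \<beta>) \<le> ip u v - F u" "nrm (v - F' u) \<le> \<delta>"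
      using conjugate_near_maximizer[OF v \<open>\<delta> > 0\<close>] .
    define z where "z = v - F' u"
    have z: "(nrm z)\<^sup>2 \<le> \<delta>\<^sup>2"
      using u(3) by (simp add: z_def power_mono)
    have zip: "\<bar>ip z x\<bar> \<le> \<delta> * nrm x" for x
      using Cauchy_Schwarz_ip[of z x] u(3) nrm_nonneg[of x]
      by (smt (verit) mult_right_mono z_def)
    have "conjugate (v + s *\<^sub>R d k) - conjugate v \<le> s * ip u (d k)
        + (\<delta>\<^sup>2 + 2 * \<delta> * s * nrm (d k) + s\<^sup>2 * (nrm (d k))\<^sup>2) / (2 * \<alpha>)" if "k \<in> K" for k
    proof -
      have "(nrm (v + s *\<^sub>R d k - F' u))\<^sup>2 = (nrm (z + s *\<^sub>R d k))\<^sup>2"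
        by (simp add: z_def algebra_simps)
      also have "\<dots> = (nrm z)\<^sup>2 + 2 * s * ip z (d k) + s\<^sup>2 * (nrm (d k))\<^sup>2"
        by (simp add: nrm_add_sq nrm_scale ip_simps power_mult_distrib)
      also have "\<dots> \<le> \<delta>\<^sup>2 + 2 * s * (\<delta> * nrm (d k)) + s\<^sup>2 * (nrm (d k))\<^sup>2"
        using zip[of "d k"] s z by (intro add_mono mult_left_mono) auto
      finally have "(nrm (v + s *\<^sub>R d k - F' u))\<^sup>2 / (2 * \<alpha>)
          \<le> (\<delta>\<^sup>2 + 2 * \<delta> * s * nrm (d k) + s\<^sup>2 * (nrm (d k))\<^sup>2) / (2 * \<alpha>)"
        using \<alpha> by (intro divide_right_mono) (auto simp: ac_simps)
      with conjugate_le[OF u(1), of "v + s *\<^sub>R d k"] conjugate_ge[OF u(1), of v] show ?thesis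
        by (simp add: ip_simps)
    qed
    then have "?L \<le> (\<Sum>k\<in>K. s * ip u (d k)
        + (\<delta>\<^sup>2 + 2 * \<delta> * s * nrm (d k) + s\<^sup>2 * (nrm (d k))\<^sup>2) / (2 * \<alpha>))"
      by (rule sum_mono)
    also have "\<dots> = s * ip u (w - v)
        + (\<Sum>k\<in>K. (\<delta>\<^sup>2 + 2 * \<delta> * s * nrm (d k) + s\<^sup>2 * (nrm (d k))\<^sup>2) / (2 * \<alpha>))"
      by (simp add: sum.distrib ip_sum_right flip: sum_distrib_left sum_d)
    also have "ip u (w - v) \<le> conjugate w - conjugate v + \<delta>\<^sup>2 / (2 * \<beta>)
      - ((nrm (w - v))\<^sup>2 - 2 * \<delta> * nrm (w - v)) / (2 * \<beta>)"
    proof -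
      have "(nrm (w - v))\<^sup>2 - 2 * \<delta> * nrm (w - v) \<le> (nrm (w - F' u))\<^sup>2"
      proof -
        have *: "w - F' u = z + (w - v)"
          by (simp add: z_def)
        show ?thesis
          unfolding * nrm_add_sq using zip[of "w - v"] zero_le_power2[of "nrm z"] by linarith
      qed
      then have "((nrm (w - v))\<^sup>2 - 2 * \<delta> * nrm (w - v)) / (2 * \<beta>) \<le> (nrm (w - F' u))\<^sup>2 / (2 * \<beta>)"
        using \<beta> by (intro divide_right_mono) auto
      with conjugate_strong_ge[OF u(1) w] u(2) show ?thesis
        by (simp add: ip_simps)
    qed
    finally show ?thesis
      using s unfolding B_def by (simp add: mult_left_mono)
  qed
  then have "\<forall>\<^sub>F \<delta> in at_right 0. ?L \<le> B \<delta>"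
    by (auto simp: eventually_at_filter)
  moreover have "(B \<longlongrightarrow> B 0) (at_right 0)"
    unfolding B_def by (intro tendsto_intros) (use \<alpha> \<beta> in auto)
  ultimately have "?L \<le> B 0"
    using tendsto_lowerbound trivial_limit_at_right_real by blast
  also have "B 0 = ?R"
    by (simp add: B_def right_diff_distrib sum_distrib_left sum_divide_distrib)
  finally show ?thesis .
qed

text \<open>Before the supremum is taken, the expression is affine in the dual variable. Hence for
  each \<open>u\<close> it splits exactly, with weight \<tau> on every \<open>v + d k\<close> and
  the rest on \<open>v\<close>; the rest is nonnegative by the bound on \<tau>.\<close>

lemma conjugate_average:
  fixes \<tau> :: real
  assumes "v \<in> X" "\<And>k. k \<in> K \<Longrightarrow> d k \<in> X" "finite K" "\<tau> \<ge> 0" "\<tau> * card K \<le> 1"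
  shows "conjugate (v + \<tau> *\<^sub>R (\<Sum>k\<in>K. d k)) \<le> conjugate v + \<tau> * (\<Sum>k\<in>K. conjugate (v + d k) - conjugate v)"
  unfolding conjugate_def[of "v + \<tau> *\<^sub>R _"]
proof (rule cSUP_least)
  show "X \<noteq> {}" using assms(1) by auto
  fix u assume u: "u \<in> X"
  have "ip u (v + \<tau> *\<^sub>R (\<Sum>k\<in>K. d k)) - F u
      = (1 - \<tau> * card K) * (ip u v - F u) + \<tau> * (\<Sum>k\<in>K. ip u (v + d k) - F u)"
    by (simp add: ip_simps ip_sum_right sum.distrib sum_subtractf algebra_simps)
  also have "\<dots> \<le> (1 - \<tau> * card K) * conjugate v + \<tau> * (\<Sum>k\<in>K. conjugate (v + d k))"
    using assms u by (intro add_mono mult_left_mono sum_mono conjugate_ge) auto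
  also have "\<dots> = conjugate v + \<tau> * (\<Sum>k\<in>K. conjugate (v + d k) - conjugate v)"
    by (simp add: sum_subtractf algebra_simps)
  finally show "ip u (v + \<tau> *\<^sub>R (\<Sum>k\<in>K. d k)) - F u
      \<le> conjugate v + \<tau> * (\<Sum>k\<in>K. conjugate (v + d k) - conjugate v)" .
qed

end


subsection \<open>Square integrable fields and Green's formula on a box\<close>

lemma bounded_on_if_continuous:
  fixes f :: "'a::euclidean_space \<Rightarrow> 'b::real_normed_vector"
  assumes "continuous_on UNIV f" "bounded S"
  obtains B where "\<And>x. x \<in> S \<Longrightarrow> norm (f x) \<le> B"
proof -
  have "bounded (f ` closure S)"
    using assms by (intro compact_imp_bounded compact_continuous_image)
      (auto intro: continuous_on_subset)
  then show thesis
    using that closure_subset[of S] unfolding bounded_iff by blast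
qed

lemma borel_measurable_lebesgue_continuous:
  "continuous_on UNIV f \<Longrightarrow> f \<in> borel_measurable lebesgue"
  by (intro measurable_completion) (simp add: borel_measurable_continuous_onI)

lemma L2_subspace: "subspace (L2 S :: (point \<Rightarrow> 'b::euclidean_space) set)"
proof (rule subspaceI)
  show "0 \<in> L2 S"
    by (simp add: L2_def set_borel_measurable_def set_integrable_def zero_fun_def)
next
  fix f g :: "point \<Rightarrow> 'b"
  assume "f \<in> L2 S" "g \<in> L2 S"
  then have [measurable]: "(\<lambda>x. indicator S x *\<^sub>R f x) \<in> borel_measurable lebesgue"
      "(\<lambda>x. indicator S x *\<^sub>R g x) \<in> borel_measurable lebesgue"
    and int: "integrable lebesgue (\<lambda>x. indicator S x *\<^sub>R (norm (f x))\<^sup>2)"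
      "integrable lebesgue (\<lambda>x. indicator S x *\<^sub>R (norm (g x))\<^sup>2)"
    by (simp_all add: L2_def set_borel_measurable_def set_integrable_def)
  have eq: "indicator S x *\<^sub>R (f + g) x = indicator S x *\<^sub>R f x + indicator S x *\<^sub>R g x" for x
    by (simp add: scaleR_add_right)
  have "set_borel_measurable lebesgue S (f + g)"
    unfolding set_borel_measurable_def eq by measurable
  moreover have "set_integrable lebesgue S (\<lambda>x. (norm ((f + g) x))\<^sup>2)"
    unfolding set_integrable_def
  proof (rule Bochner_Integration.integrable_bound)
    show "integrable lebesgue (\<lambda>x. 2 * (indicator S x *\<^sub>R (norm (f x))\<^sup>2)
        + 2 * (indicator S x *\<^sub>R (norm (g x))\<^sup>2))"
      using int by auto
    \<comment> \<open>Only the restrictions to \<open>S\<close> are known to be measurable, so the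
      indicator has to move inside the norm.\<close>
    have "(\<lambda>x. indicator S x *\<^sub>R (norm ((f + g) x))\<^sup>2)
        = (\<lambda>x. (norm (indicator S x *\<^sub>R f x + indicator S x *\<^sub>R g x))\<^sup>2)"
      by (auto simp: indicator_def)
    also have "\<dots> \<in> borel_measurable lebesgue"
      by measurable
    finally show "(\<lambda>x. indicator S x *\<^sub>R (norm ((f + g) x))\<^sup>2) \<in> borel_measurable lebesgue" .
    have "(norm (f x + g x))\<^sup>2 \<le> 2 * (norm (f x))\<^sup>2 + 2 * (norm (g x))\<^sup>2" for x
    proof -
      have "(norm (f x + g x))\<^sup>2 \<le> (norm (f x) + norm (g x))\<^sup>2"
        by (intro power_mono norm_triangle_ineq) auto
      also have "\<dots> \<le> 2 * (norm (f x))\<^sup>2 + 2 * (norm (g x))\<^sup>2"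
        using sum_squares_bound[of "norm (f x)" "norm (g x)"] by (simp add: power2_sum)
      finally show ?thesis .
    qed
    then show "AE x in lebesgue. norm (indicator S x *\<^sub>R (norm ((f + g) x))\<^sup>2)
        \<le> norm (2 * (indicator S x *\<^sub>R (norm (f x))\<^sup>2) + 2 * (indicator S x *\<^sub>R (norm (g x))\<^sup>2))"
      by (auto simp: indicator_def)
  qed
  ultimately show "f + g \<in> L2 S"
    by (simp add: L2_def)
next
  fix c :: real and f :: "point \<Rightarrow> 'b"
  assume "f \<in> L2 S"
  then have [measurable]: "(\<lambda>x. indicator S x *\<^sub>R f x) \<in> borel_measurable lebesgue"
    and int: "integrable lebesgue (\<lambda>x. indicator S x *\<^sub>R (norm (f x))\<^sup>2)"
    by (simp_all add: L2_def set_borel_measurable_def set_integrable_def)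
  have "(\<lambda>x. indicator S x *\<^sub>R (c *\<^sub>R f) x) = (\<lambda>x. c *\<^sub>R (indicator S x *\<^sub>R f x))"
    by (simp add: scaleR_fun_def mult.commute)
  then have "set_borel_measurable lebesgue S (c *\<^sub>R f)"
    unfolding set_borel_measurable_def by (simp only:) measurable
  moreover have "(\<lambda>x. indicator S x *\<^sub>R (norm ((c *\<^sub>R f) x))\<^sup>2)
      = (\<lambda>x. c\<^sup>2 * (indicator S x *\<^sub>R (norm (f x))\<^sup>2))"
    by (simp add: scaleR_fun_def power_mult_distrib mult_ac)
  then have "set_integrable lebesgue S (\<lambda>x. (norm ((c *\<^sub>R f) x))\<^sup>2)"
    unfolding set_integrable_def using int by simp
  ultimately show "c *\<^sub>R f \<in> L2 S"
    by (simp add: L2_def)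
qed

text \<open>On a set of finite measure, \<open>norm (f x)\<close> is dominated by the integrable
  function \<open>1 + (norm (f x))\<^sup>2\<close>, and \<open>g\<close> is bounded on the bounded
  set \<open>S\<close>.\<close>

lemma L2_inner_integrable:
  assumes f: "f \<in> L2 S" and S: "S \<in> lmeasurable" "bounded S" and g: "continuous_on UNIV g"
  shows "set_integrable lebesgue S (\<lambda>x. f x \<bullet> g x)"
proof -
  obtain B where B: "\<And>x. x \<in> S \<Longrightarrow> norm (g x) \<le> B"
    using bounded_on_if_continuous[OF g S(2)] by blast
  have [measurable]: "(\<lambda>x. indicator S x *\<^sub>R f x) \<in> borel_measurable lebesgue"
      "g \<in> borel_measurable lebesgue"
    and int: "integrable lebesgue (\<lambda>x. indicator S x *\<^sub>R (norm (f x))\<^sup>2)"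
    using f borel_measurable_lebesgue_continuous[OF g]
    by (simp_all add: L2_def set_borel_measurable_def set_integrable_def)
  show ?thesis
    unfolding set_integrable_def
  proof (rule Bochner_Integration.integrable_bound)
    show "integrable lebesgue (\<lambda>x. \<bar>B\<bar> * (indicator S x + indicator S x *\<^sub>R (norm (f x))\<^sup>2))"
      using int S by (auto simp: fmeasurable_def)
    have "(\<lambda>x. indicator S x *\<^sub>R (f x \<bullet> g x)) = (\<lambda>x. (indicator S x *\<^sub>R f x) \<bullet> g x)"
      by simp
    also have "\<dots> \<in> borel_measurable lebesgue"
      by measurable
    finally show "(\<lambda>x. indicator S x *\<^sub>R (f x \<bullet> g x)) \<in> borel_measurable lebesgue" .
    have "\<bar>f x \<bullet> g x\<bar> \<le> \<bar>B\<bar> * (1 + (norm (f x))\<^sup>2)" if "x \<in> S" for x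
    proof -
      have "\<bar>f x \<bullet> g x\<bar> \<le> norm (f x) * norm (g x)"
        by (rule Cauchy_Schwarz_ineq2)
      also have "\<dots> \<le> (1 + (norm (f x))\<^sup>2) * \<bar>B\<bar>"
      proof (intro mult_mono)
        show "norm (f x) \<le> 1 + (norm (f x))\<^sup>2"
          using sum_squares_bound[of 1 "norm (f x)"] norm_ge_zero[of "f x"] by (simp del: norm_ge_zero)
      qed (use B[OF that] in auto)
      finally show ?thesis
        by (simp add: mult.commute)
    qed
    then show "AE x in lebesgue. norm (indicator S x *\<^sub>R (f x \<bullet> g x))
        \<le> norm (\<bar>B\<bar> * (indicator S x + indicator S x *\<^sub>R (norm (f x))\<^sup>2))"
      by (auto simp: indicator_def abs_mult)
  qed
qed

lemma C1_with_gradient_continuous: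
  assumes "C1_with_gradient \<phi> g"
  shows "continuous_on UNIV \<phi>" "continuous_on UNIV g"
proof -
  have "isCont \<phi> x" for x
    using assms unfolding C1_with_gradient_def gderiv_def by (blast intro: has_derivative_continuous)
  then show "continuous_on UNIV \<phi>"
    by (simp add: continuous_at_imp_continuous_on)
  show "continuous_on UNIV g"
    using assms by (simp add: C1_with_gradient_def)
qed

lemma C1_with_gradient_mult:
  assumes "C1_with_gradient \<phi> g" "C1_with_gradient \<psi> k"
  shows "C1_with_gradient (\<lambda>x. \<phi> x * \<psi> x) (\<lambda>x. \<phi> x *\<^sub>R k x + \<psi> x *\<^sub>R g x)"
  unfolding C1_with_gradient_def
  using assms[THEN C1_with_gradient_continuous(1)] assms[THEN C1_with_gradient_continuous(2)] assms
  by (auto simp: C1_with_gradient_def intro!: GDERIV_mult continuous_intros)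

lemma C1_with_gradient_compose:
  assumes "C1_with_gradient \<phi> g" "\<And>t. (f has_real_derivative f' t) (at t)" "continuous_on UNIV f'"
  shows "C1_with_gradient (\<lambda>x. f (\<phi> x)) (\<lambda>x. f' (\<phi> x) *\<^sub>R g x)"
  unfolding C1_with_gradient_def
proof (intro conjI allI)
  show "GDERIV (\<lambda>x. f (\<phi> x)) x :> f' (\<phi> x) *\<^sub>R g x" for x
    using assms(1) by (intro GDERIV_DERIV_compose[OF _ assms(2)]) (unfold C1_with_gradient_def, blast)
  show "continuous_on UNIV (\<lambda>x. f' (\<phi> x) *\<^sub>R g x)"
    using C1_with_gradient_continuous[OF assms(1)]
    by (intro continuous_on_scaleR continuous_on_compose2[OF assms(3)]) auto
qed

lemma C1_with_gradient_partial:
  assumes "C1_with_gradient \<phi> g"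
  shows "((\<lambda>t. \<phi> (t, y)) has_real_derivative fst (g (x, y))) (at x)"
    "((\<lambda>t. \<phi> (x, t)) has_real_derivative snd (g (x, y))) (at y)"
proof -
  have D: "(\<phi> has_derivative (\<lambda>v. v \<bullet> g (x, y))) (at (x, y))"
    using assms by (simp add: C1_with_gradient_def gderiv_def)
  have "((\<lambda>t. \<phi> (t, y)) has_derivative (\<lambda>t. (t, 0) \<bullet> g (x, y))) (at x)"
    by (rule has_derivative_compose[OF has_derivative_Pair[OF has_derivative_ident has_derivative_const] D])
  also have "(\<lambda>t. (t, 0) \<bullet> g (x, y)) = (*) (fst (g (x, y)))"
    by (simp add: inner_prod_def fun_eq_iff)
  finally show "((\<lambda>t. \<phi> (t, y)) has_real_derivative fst (g (x, y))) (at x)"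
    by (simp only: has_field_derivative_def)
  have "((\<lambda>t. \<phi> (x, t)) has_derivative (\<lambda>t. (0, t) \<bullet> g (x, y))) (at y)"
    by (rule has_derivative_compose[OF has_derivative_Pair[OF has_derivative_const has_derivative_ident] D])
  also have "(\<lambda>t. (0, t) \<bullet> g (x, y)) = (*) (snd (g (x, y)))"
    by (simp add: inner_prod_def fun_eq_iff)
  finally show "((\<lambda>t. \<phi> (x, t)) has_real_derivative snd (g (x, y))) (at y)"
    by (simp only: has_field_derivative_def)
qed

text \<open>Each component of the field depends on its own coordinate only, so the integrand is a
  sum of two exact derivatives, one per coordinate direction. Integrating along lines leaves values
  of \<psi> on the sides of the box, which are zero.\<close>

lemma box_green_RT0:
  assumes C1: "C1_with_gradient \<psi> g" and le: "a \<le> b" "c \<le> d"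
    and zero: "\<And>y. y \<in> {c..d} \<Longrightarrow> \<psi> (a, y) = 0" "\<And>y. y \<in> {c..d} \<Longrightarrow> \<psi> (b, y) = 0"
      "\<And>x. x \<in> {a..b} \<Longrightarrow> \<psi> (x, c) = 0" "\<And>x. x \<in> {a..b} \<Longrightarrow> \<psi> (x, d) = 0"
  shows "(LINT x:box (a, c) (b, d)|lebesgue.
      (a1 + b1 * fst x, a2 + b2 * snd x) \<bullet> g x + (b1 + b2) * \<psi> x) = 0"
proof -
  note cont = C1_with_gradient_continuous[OF C1]
  have [continuous_intros]: "continuous_on A (\<lambda>x. \<psi> (k x))" "continuous_on A (\<lambda>x. g (k x))"
    if "continuous_on A k" for A :: "'z::topological_space set" and k
    using cont that by (auto intro: continuous_on_compose2[of UNIV])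
  let ?f1 = "\<lambda>x. (a1 + b1 * fst x) * fst (g x) + b1 * \<psi> x"
  let ?f2 = "\<lambda>x. (a2 + b2 * snd x) * snd (g x) + b2 * \<psi> x"
  have c1: "continuous_on A ?f1" and c2: "continuous_on A ?f2" for A
    by (intro continuous_intros)+
  have i1: "integral {a..b} (\<lambda>x. ?f1 (x, y)) = 0" if "y \<in> {c..d}" for y
  proof -
    have "((\<lambda>x. ?f1 (x, y)) has_integral
        (a1 + b1 * b) * \<psi> (b, y) - (a1 + b1 * a) * \<psi> (a, y)) {a..b}"
    proof (intro fundamental_theorem_of_calculus[OF le(1)])
      fix x
      have "((\<lambda>x. (a1 + b1 * x) * \<psi> (x, y)) has_real_derivative
          b1 * \<psi> (x, y) + fst (g (x, y)) * (a1 + b1 * x)) (at x)"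
        by (rule DERIV_mult[OF _ C1_with_gradient_partial(1)[OF C1]]) (auto intro!: derivative_eq_intros)
      then show "((\<lambda>x. (a1 + b1 * x) * \<psi> (x, y)) has_vector_derivative ?f1 (x, y)) (at x within {a..b})"
        by (auto simp: mult.commute add.commute simp flip: has_real_derivative_iff_has_vector_derivative
            intro: has_field_derivative_at_within)
    qed
    then show ?thesis
      using zero that by (simp add: integral_unique)
  qed
  have i2: "integral {c..d} (\<lambda>y. ?f2 (x, y)) = 0" if "x \<in> {a..b}" for x
  proof -
    have "((\<lambda>y. ?f2 (x, y)) has_integral
        (a2 + b2 * d) * \<psi> (x, d) - (a2 + b2 * c) * \<psi> (x, c)) {c..d}"
    proof (intro fundamental_theorem_of_calculus[OF le(2)])
      fix y
      have "((\<lambda>y. (a2 + b2 * y) * \<psi> (x, y)) has_real_derivative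
          b2 * \<psi> (x, y) + snd (g (x, y)) * (a2 + b2 * y)) (at y)"
        by (rule DERIV_mult[OF _ C1_with_gradient_partial(2)[OF C1]]) (auto intro!: derivative_eq_intros)
      then show "((\<lambda>y. (a2 + b2 * y) * \<psi> (x, y)) has_vector_derivative ?f2 (x, y)) (at y within {c..d})"
        by (auto simp: mult.commute add.commute simp flip: has_real_derivative_iff_has_vector_derivative
            intro: has_field_derivative_at_within)
    qed
    then show ?thesis
      using zero that by (simp add: integral_unique)
  qed
  \<comment> \<open>\<open>integral_prod_continuous\<close> puts the second coordinate innermost,
    whereas \<open>?f1\<close> has to be integrated in the first coordinate first.\<close>
  have "integral (cbox (a, c) (b, d)) ?f1
      = integral (cbox c d) (\<lambda>y. integral (cbox a b) (\<lambda>x. ?f1 (x, y)))"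
    unfolding integral_prod_continuous[OF c1]
    by (rule integral_swap_continuous) (use c1 in \<open>simp add: case_prod_unfold\<close>)
  also have "\<dots> = integral (cbox c d) (\<lambda>y. 0)"
    using i1 by (intro integral_cong) simp
  finally have 1: "integral (cbox (a, c) (b, d)) ?f1 = 0" by simp
  have "integral (cbox (a, c) (b, d)) ?f2
      = integral (cbox a b) (\<lambda>x. integral (cbox c d) (\<lambda>y. ?f2 (x, y)))"
    using c2 by (simp only: integral_prod_continuous)
  also have "\<dots> = integral (cbox a b) (\<lambda>x. 0)"
    using i2 by (intro integral_cong) simp
  finally have 2: "integral (cbox (a, c) (b, d)) ?f2 = 0" by simp
  have eq: "(a1 + b1 * fst x, a2 + b2 * snd x) \<bullet> g x + (b1 + b2) * \<psi> x = ?f1 x + ?f2 x" for x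
    by (simp add: inner_prod_def algebra_simps)
  have "set_integrable lebesgue (cbox (a, c) (b, d)) (\<lambda>x. ?f1 x + ?f2 x)"
    using continuous_on_add[OF c1 c2]
    by (intro absolutely_integrable_continuous)
  then have "set_integrable lebesgue (box (a, c) (b, d)) (\<lambda>x. ?f1 x + ?f2 x)"
    by (rule set_integrable_subset) (auto simp: box_subset_cbox)
  then have "(LINT x:box (a, c) (b, d)|lebesgue. ?f1 x + ?f2 x)
      = integral (box (a, c) (b, d)) (\<lambda>x. ?f1 x + ?f2 x)"
    by (rule set_lebesgue_integral_eq_integral)
  also have "\<dots> = 0"
    unfolding integral_open_interval
    using 1 2 c1 c2 by (subst integral_add) (auto intro: integrable_continuous)
  finally show ?thesis
    unfolding eq .
qed


subsection \<open>The mesh\<close>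

locale mesh =
  fixes m1 m2 :: nat and h :: real
  assumes h: "h > 0"
begin

abbreviation \<Omega> :: "point set"
  where "\<Omega> \<equiv> Omega m1 m2 h"

abbreviation cells :: "(nat \<times> nat) set"
  where "cells \<equiv> {..<m1} \<times> {..<m2}"

lemma Omega_eq_box: "\<Omega> = box (0, 0) (real m1 * h, real m2 * h)"
  by (simp add: Omega_def box_prod)

lemma elem_eq_box: "elem h i j = box (real i * h, real j * h) (real (i + 1) * h, real (j + 1) * h)"
  by (simp add: elem_def box_prod)

lemma Omega_lmeasurable: "\<Omega> \<in> lmeasurable" and bounded_Omega: "bounded \<Omega>"
  by (auto simp: Omega_eq_box)

lemma measure_Omega: "measure lebesgue \<Omega> = h\<^sup>2 * (real m1 * real m2)"
proof -
  have "measure lebesgue \<Omega> = measure lborel (cbox (0, 0) (real m1 * h, real m2 * h))"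
    unfolding Omega_eq_box by (simp add: measure_lborel_box_eq measure_lborel_cbox_eq del: cbox_Pair_iff)
  also have "\<dots> = h\<^sup>2 * (real m1 * real m2)"
    using h by (simp add: content_Pair power2_eq_square)
  finally show ?thesis .
qed

lemma elem_nonempty: "elem h i j \<noteq> {}"
  using h by (auto simp: elem_def)

lemma open_elem: "open (elem h i j)"
  unfolding elem_eq_box by (rule open_box)

lemma elem_interval_unique:
  fixes x :: real and i i' :: nat
  assumes "real i * h < x" "x < real (i + 1) * h" "real i' * h < x" "x < real (i' + 1) * h"
  shows "i = i'"
proof -
  have "real i * h < real (i' + 1) * h" "real i' * h < real (i + 1) * h"
    using assms by linarith+
  then have "real i < real (i' + 1)" "real i' < real (i + 1)"
    using h by (simp_all only: mult_less_cancel_right_pos)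
  then show ?thesis by linarith
qed

lemma elem_unique:
  assumes "x \<in> elem h i j" "x \<in> elem h i' j'"
  shows "i = i' \<and> j = j'"
proof
  have "real i * h < fst x" "fst x < real (i + 1) * h" "real i' * h < fst x" "fst x < real (i' + 1) * h"
    using assms by (auto simp: elem_def)
  then show "i = i'"
    by (rule elem_interval_unique)
  have "real j * h < snd x" "snd x < real (j + 1) * h" "real j' * h < snd x" "snd x < real (j' + 1) * h"
    using assms by (auto simp: elem_def)
  then show "j = j'"
    by (rule elem_interval_unique)
qed

lemma Th_eq: "Th m1 m2 h = (\<lambda>(i, j). elem h i j) ` cells"
  by (auto simp: Th_def)

lemma elem_in_Th: "i < m1 \<Longrightarrow> j < m2 \<Longrightarrow> elem h i j \<in> Th m1 m2 h"
  by (auto simp: Th_def)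

lemma finite_Th: "finite (Th m1 m2 h)"
  by (simp add: Th_eq)

lemma elem_subset_Omega:
  assumes "i < m1" "j < m2"
  shows "elem h i j \<subseteq> \<Omega>"
proof -
  have "real (i + 1) * h \<le> real m1 * h" "real (j + 1) * h \<le> real m2 * h"
    using assms h by (intro mult_right_mono; simp)+
  moreover have "0 \<le> real i * h" "0 \<le> real j * h"
    using h by auto
  ultimately show ?thesis
    unfolding elem_def Omega_def by (auto simp del: of_nat_add of_nat_Suc)
qed

lemma Union_Th_subset: "\<Union>(Th m1 m2 h) \<subseteq> \<Omega>"
  using elem_subset_Omega by (auto simp: Th_def)

lemma grid_interval:
  assumes "0 < x" "x < real m * h"
  obtains i where "i < m" "x = real i * h" | i where "i < m" "real i * h < x" "x < real (i + 1) * h"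
proof -
  define i where "i = nat \<lfloor>x / h\<rfloor>"
  have "real i = of_int \<lfloor>x / h\<rfloor>"
    using assms h by (simp add: i_def)
  then have "real i \<le> x / h" "x / h < real i + 1"
    by linarith+
  then have le: "real i * h \<le> x" "x < real (i + 1) * h"
    using h by (simp_all add: field_simps)
  then have "real i * h < real m * h"
    using assms by linarith
  then have "i < m"
    using h by simp
  with le that show thesis by (cases "x = real i * h") auto
qed

lemma negligible_skeleton: "negligible (\<Omega> - \<Union>(Th m1 m2 h))"
proof (rule negligible_subset)
  let ?S = "(\<Union>i<m1. {x::point. x \<bullet> (1, 0) = real i * h}) \<union> (\<Union>j<m2. {x. x \<bullet> (0, 1) = real j * h})"
  show "negligible ?S"
    by (intro negligible_Un negligible_Union negligible_standard_hyperplane)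
      (auto intro!: negligible_standard_hyperplane simp: Basis_prod_def)
  show "\<Omega> - \<Union>(Th m1 m2 h) \<subseteq> ?S"
  proof
    fix z assume z: "z \<in> \<Omega> - \<Union>(Th m1 m2 h)"
    obtain x y where xy: "z = (x, y)" by fastforce
    from z have b: "0 < x" "x < real m1 * h" "0 < y" "y < real m2 * h"
      by (auto simp: xy Omega_def)
    show "z \<in> ?S"
    proof (cases rule: grid_interval[OF b(1,2)])
      case (2 i)
      note i = this
      show ?thesis
      proof (cases rule: grid_interval[OF b(3,4)])
        case (2 j)
        with i have "z \<in> elem h i j" "elem h i j \<in> Th m1 m2 h"
          by (auto simp: elem_def Th_def xy)
        with z show ?thesis by blast
      qed (auto simp: xy)
    qed (auto simp: xy)
  qed
qed

lemma AE_mesh: "AE x in lebesgue. x \<in> \<Omega> \<longrightarrow> x \<in> \<Union>(Th m1 m2 h)"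
proof -
  have "AE x in lebesgue. x \<notin> \<Omega> - \<Union>(Th m1 m2 h)"
    using negligible_skeleton by (intro AE_not_in) (simp add: negligible_iff_null_sets)
  then show ?thesis
    by (rule eventually_mono) blast
qed

lemma set_integral_Omega:
  fixes f :: "point \<Rightarrow> real"
  assumes "set_integrable lebesgue \<Omega> f"
  shows "(LINT x:\<Omega>|lebesgue. f x) = (\<Sum>(i, j)\<in>cells. LINT x:elem h i j|lebesgue. f x)"
proof -
  have meas: "elem h i j \<in> sets lebesgue" for i j
    by (simp add: elem_eq_box)
  have U: "(\<Union>(i, j)\<in>cells. elem h i j) = \<Union>(Th m1 m2 h)"
    by (simp add: Th_eq)
  have sub: "set_integrable lebesgue A f" if "A \<in> sets lebesgue" "A \<subseteq> \<Omega>" for A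
    using assms that by (rule set_integrable_subset)
  have "\<Union>(Th m1 m2 h) \<in> sets lebesgue"
    using meas unfolding U[symmetric] by (intro sets.finite_UN) auto
  then have "(LINT x:\<Omega>|lebesgue. f x) = (LINT x:\<Union>(Th m1 m2 h)|lebesgue. f x)"
    using sub[OF _ Union_Th_subset] assms AE_mesh Union_Th_subset
    by (intro set_integral_cong_set) (auto simp: set_integrable_def set_borel_measurable_def elim: eventually_mono)
  also have "\<dots> = (\<Sum>(i, j)\<in>cells. LINT x:elem h i j|lebesgue. f x)"
    unfolding U[symmetric] case_prod_unfold
    using meas elem_subset_Omega
    by (intro set_integral_finite_Union sub)
      (fastforce simp: disjoint_family_on_def dest: elem_unique)+
  finally show ?thesis .
qed

text \<open>
  The cutoff vanishes on the grid lines, so that Green's formula on each element has no boundary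
  terms for test functions multiplied by it, and tends to 1 off the grid lines.
\<close>

definition cutoff :: "nat \<Rightarrow> point \<Rightarrow> real"
  where "cutoff n x = 1 - 1 / (1 + real n * (sin (pi * fst x / h) * sin (pi * snd x / h))\<^sup>2)"

lemma cutoff_bounds: "0 \<le> cutoff n x" "cutoff n x \<le> 1"
  by (simp_all add: cutoff_def divide_le_eq add_pos_nonneg)

lemma cutoff_grid:
  "cutoff n (real i * h, y) = 0" "cutoff n (x, real j * h) = 0"
  using h by (simp_all add: cutoff_def)

lemma cutoff_tendsto:
  assumes "x \<in> \<Union>(Th m1 m2 h)"
  shows "(\<lambda>n. cutoff n x) \<longlonglongrightarrow> 1"
proof -
  \<comment> \<open>A zero of the sine is an integer multiple of \<open>h\<close>, and none lies
    strictly between consecutive multiples.\<close>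
  have nz: "sin (pi * t / h) \<noteq> 0" if "real i * h < t" "t < real (i + 1) * h" for t :: real and i :: nat
  proof
    assume "sin (pi * t / h) = 0"
    then obtain k :: int where "pi * t / h = of_int k * pi"
      by (auto simp: sin_zero_iff_int2)
    then have "t = of_int k * h"
      using h by (simp add: field_simps)
    then have "of_int (int i) * h < of_int k * h" "of_int k * h < of_int (int i + 1) * h"
      using that by (simp_all add: add.commute)
    then have "of_int (int i) < (of_int k :: real)" "of_int k < (of_int (int i + 1) :: real)"
      using h by (simp_all only: mult_less_cancel_right_pos)
    then show False
      unfolding of_int_less_iff by linarith
  qed
  define c where "c = (sin (pi * fst x / h) * sin (pi * snd x / h))\<^sup>2"
  have "c > 0"
    using assms nz unfolding c_def by (auto simp: Th_def elem_def simp del: of_nat_add of_nat_Suc)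
  then have "filterlim (\<lambda>n. c * real n) at_top sequentially"
    by (intro filterlim_tendsto_pos_mult_at_top[OF tendsto_const] filterlim_real_sequentially)
  then have "(\<lambda>n. 1 / (1 + c * real n)) \<longlonglongrightarrow> 0"
    by (intro tendsto_divide_0[OF tendsto_const] filterlim_at_top_imp_at_infinity
        filterlim_tendsto_add_at_top[OF tendsto_const])
  from tendsto_diff[OF tendsto_const[of 1] this] show ?thesis
    by (simp add: cutoff_def c_def mult.commute)
qed

lemma C1_cutoff: "\<exists>g. C1_with_gradient (cutoff n) g"
proof -
  let ?s = "\<lambda>x::point. sin (pi * fst x / h) * sin (pi * snd x / h)"
  let ?g = "\<lambda>x::point. (pi / h * cos (pi * fst x / h) * sin (pi * snd x / h),
      pi / h * sin (pi * fst x / h) * cos (pi * snd x / h))"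
  let ?f' = "\<lambda>t::real. 2 * real n * t / (1 + real n * t\<^sup>2)\<^sup>2"
  have "C1_with_gradient ?s ?g"
    unfolding C1_with_gradient_def gderiv_def
  proof (intro conjI allI)
    show "(?s has_derivative (\<lambda>v. v \<bullet> ?g x)) (at x)" for x
      using h by (auto intro!: derivative_eq_intros simp: inner_prod_def fun_eq_iff field_simps)
    show "continuous_on UNIV ?g"
      using h by (intro continuous_intros) auto
  qed
  moreover have pos: "1 + real n * t\<^sup>2 > 0" for t
    by (simp add: add_pos_nonneg)
  have "((\<lambda>t. 1 - 1 / (1 + real n * t\<^sup>2)) has_real_derivative ?f' t) (at t)" for t
    using pos[of t] by (auto intro!: derivative_eq_intros simp: power2_eq_square)
  moreover have "continuous_on UNIV ?f'"
    using pos by (intro continuous_intros) (simp add: less_imp_neq[symmetric])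
  ultimately have "C1_with_gradient (\<lambda>x. 1 - 1 / (1 + real n * (?s x)\<^sup>2)) (\<lambda>x. ?f' (?s x) *\<^sub>R ?g x)"
    by (rule C1_with_gradient_compose)
  then show ?thesis
    unfolding cutoff_def[abs_def] by blast
qed

text \<open>Dominated convergence, with the integrand without cutoff as majorant and the grid lines
  as the exceptional null set. It is stated for arbitrary \<open>d\<close> in \<open>L2\<close>
  because it is applied both to the given weak divergence and to the elementwise constant
  candidate.\<close>

lemma set_integral_cutoff_tendsto:
  assumes d: "d \<in> L2 \<Omega>" and \<phi>: "continuous_on UNIV \<phi>"
  shows "(\<lambda>n. LINT x:\<Omega>|lebesgue. d x * (cutoff n x * \<phi> x)) \<longlonglongrightarrow> (LINT x:\<Omega>|lebesgue. d x * \<phi> x)"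
  unfolding set_lebesgue_integral_def
proof (rule integral_dominated_convergence)
  have int: "set_integrable lebesgue \<Omega> (\<lambda>x. d x * k x)" if "continuous_on UNIV k" for k :: "point \<Rightarrow> real"
    using L2_inner_integrable[OF d Omega_lmeasurable bounded_Omega that] by simp
  have "continuous_on UNIV (cutoff n)" for n
    using C1_cutoff C1_with_gradient_continuous by blast
  then show "(\<lambda>x. indicator \<Omega> x *\<^sub>R (d x * (cutoff n x * \<phi> x))) \<in> borel_measurable lebesgue" for n
    using int[of "\<lambda>x. cutoff n x * \<phi> x"] \<phi>
    unfolding set_integrable_def by (intro borel_measurable_integrable) (auto intro: continuous_intros)
  show "integrable lebesgue (\<lambda>x. norm (indicator \<Omega> x *\<^sub>R (d x * \<phi> x)))"
    using int[OF \<phi>] unfolding set_integrable_def by (rule integrable_norm)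
  then show "(\<lambda>x. indicator \<Omega> x *\<^sub>R (d x * \<phi> x)) \<in> borel_measurable lebesgue"
    using int[OF \<phi>] unfolding set_integrable_def by (intro borel_measurable_integrable)
  show "AE x in lebesgue. norm (indicator \<Omega> x *\<^sub>R (d x * (cutoff n x * \<phi> x)))
      \<le> norm (indicator \<Omega> x *\<^sub>R (d x * \<phi> x))" for n
    using cutoff_bounds[of n] by (auto simp: indicator_def abs_mult intro!: mult_left_mono mult_left_le_one_le)
  show "AE x in lebesgue. (\<lambda>n. indicator \<Omega> x *\<^sub>R (d x * (cutoff n x * \<phi> x)))
      \<longlonglongrightarrow> indicator \<Omega> x *\<^sub>R (d x * \<phi> x)"
    using AE_mesh
  proof (rule eventually_mono)
    fix x assume "x \<in> \<Omega> \<longrightarrow> x \<in> \<Union>(Th m1 m2 h)"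
    then show "(\<lambda>n. indicator \<Omega> x *\<^sub>R (d x * (cutoff n x * \<phi> x)))
        \<longlonglongrightarrow> indicator \<Omega> x *\<^sub>R (d x * \<phi> x)"
    proof (cases "x \<in> \<Omega>")
      case True
      with \<open>_ \<longrightarrow> _\<close> have "(\<lambda>n. d x * (cutoff n x * \<phi> x)) \<longlonglongrightarrow> d x * (1 * \<phi> x)"
        by (intro tendsto_intros cutoff_tendsto) auto
      with True show ?thesis by simp
    qed simp
  qed
qed

end


section \<open>Bump functions, local Raviart-Thomas fields and traces\<close>

lemma sum_fun_apply: "(\<Sum>k\<in>A. f k) x = (\<Sum>k\<in>A. f k x)"
  for f :: "'a \<Rightarrow> 'b \<Rightarrow> 'c::comm_monoid_add"
  by (induction A rule: infinite_finite_induct) simp_all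

lemma DERIV_max_0_square: "((\<lambda>t. (max 0 t)\<^sup>2) has_real_derivative 2 * max 0 t) (at t)"
proof -
  consider "t < 0" | "t = 0" | "t > 0" by linarith
  then show ?thesis
  proof cases
    case 1
    have "((\<lambda>t. (max 0 t)\<^sup>2) has_real_derivative 0) (at t)"
      by (rule has_field_derivative_transform_within_open[where f = "\<lambda>_. 0" and S = "{..<0}"])
        (use 1 in auto)
    then show ?thesis using 1 by simp
  next
    case 2
    \<comment> \<open>This is the difference quotient at 0.\<close>
    have "(max 0 x)\<^sup>2 / x = max 0 x" for x :: real
      by (simp add: max_def power2_eq_square)
    moreover have "((\<lambda>x::real. max 0 x) \<longlongrightarrow> max 0 0) (at 0)"
      by (intro tendsto_intros)
    ultimately show ?thesis
      using 2 by (simp add: DERIV_def)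
  next
    case 3
    have "((\<lambda>t. (max 0 t)\<^sup>2) has_real_derivative 2 * t) (at t)"
      by (rule has_field_derivative_transform_within_open[where f = "\<lambda>t. t\<^sup>2" and S = "{0<..}"])
        (use 3 in \<open>auto intro!: derivative_eq_intros\<close>)
    then show ?thesis using 3 by simp
  qed
qed

text \<open>Test functions are continuously differentiable, and squaring the positive part achieves
  exactly this smoothness with support in a closed ball.\<close>

lemma C1_bump: "\<exists>g. C1_with_gradient (\<lambda>x. (max 0 (r\<^sup>2 - (dist c x)\<^sup>2))\<^sup>2) g"
proof -
  have "C1_with_gradient (\<lambda>x. r\<^sup>2 - (dist c x)\<^sup>2) (\<lambda>x. 2 *\<^sub>R (c - x))"
    unfolding C1_with_gradient_def gderiv_def dist_norm power2_norm_eq_inner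
  proof (intro conjI allI)
    show "((\<lambda>x. r\<^sup>2 - (c - x) \<bullet> (c - x)) has_derivative (\<lambda>v. v \<bullet> 2 *\<^sub>R (c - x))) (at x)" for x
      by (auto intro!: derivative_eq_intros simp: inner_commute)
  qed (intro continuous_intros)
  moreover have "continuous_on UNIV (\<lambda>t::real. 2 * max 0 t)"
    by (intro continuous_intros)
  ultimately show ?thesis
    using C1_with_gradient_compose[OF _ DERIV_max_0_square] by blast
qed

lemma RT0_iff:
  "p \<in> RT0 T \<longleftrightarrow> (\<exists>a1 b1 a2 b2. \<forall>x\<in>T. p x = (a1 + b1 * fst x, a2 + b2 * snd x))"
  by (auto simp: RT0_def case_prod_unfold)

lemma RT0_subspace: "subspace (RT0 T)"
proof (rule subspaceI)
  show "0 \<in> RT0 T"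
    by (auto simp: RT0_iff zero_prod_def intro!: exI[of _ 0])
next
  fix p q assume "p \<in> RT0 T" "q \<in> RT0 T"
  then obtain a1 b1 a2 b2 a1' b1' a2' b2' where
    "\<forall>x\<in>T. p x = (a1 + b1 * fst x, a2 + b2 * snd x)"
    "\<forall>x\<in>T. q x = (a1' + b1' * fst x, a2' + b2' * snd x)"
    unfolding RT0_iff by metis
  then have "\<forall>x\<in>T. (p + q) x = ((a1 + a1') + (b1 + b1') * fst x, (a2 + a2') + (b2 + b2') * snd x)"
    by (simp add: algebra_simps)
  then show "p + q \<in> RT0 T"
    unfolding RT0_iff by blast
next
  fix c p assume "p \<in> RT0 T"
  then obtain a1 b1 a2 b2 where "\<forall>x\<in>T. p x = (a1 + b1 * fst x, a2 + b2 * snd x)"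
    unfolding RT0_iff by blast
  then have "\<forall>x\<in>T. (c *\<^sub>R p) x = ((c * a1) + (c * b1) * fst x, (c * a2) + (c * b2) * snd x)"
    by (simp add: scaleR_fun_def algebra_simps)
  then show "c *\<^sub>R p \<in> RT0 T"
    unfolding RT0_iff by blast
qed

text \<open>The limit within \<open>T\<close> sees only the values of \<open>p\<close> in the open
  element. This matters because members of \<open>Yh\<close> are set to 0 on the grid lines.\<close>

lemma trace_from_eq:
  assumes T: "open T" and z: "z \<in> closure T" and p: "\<And>x. x \<in> T \<Longrightarrow> p x = f x" and f: "isCont f z"
  shows "trace_from T p z = f z"
  unfolding trace_from_def
proof (rule tendsto_Lim)
  have "z islimpt T"
    using z T by (auto simp: closure_def intro: open_imp_islimpt)
  then show "\<not> trivial_limit (at z within T)"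
    by (simp add: trivial_limit_within)
  have "(f \<longlongrightarrow> f z) (at z within T)"
    using f by (simp add: isCont_def tendsto_within_subset[of f _ z UNIV])
  moreover have "\<forall>\<^sub>F x in at z within T. f x = p x"
    using p by (auto simp: eventually_at_filter)
  ultimately show "(p \<longlongrightarrow> f z) (at z within T)"
    by (rule Lim_transform_eventually)
qed

section \<open>Linear structure of the spaces and the discrete divergence\<close>

context mesh
begin

text \<open>The value type is polymorphic: one instance pairs fields with gradients, the other pairs
  scalar divergences with test functions, where the inner product is multiplication.\<close>

lemma set_integral_lincomb:
  assumes "p \<in> L2 \<Omega>" "q \<in> L2 \<Omega>" and g: "continuous_on UNIV g"
  shows "(LINT x:\<Omega>|lebesgue. (a *\<^sub>R p + b *\<^sub>R q) x \<bullet> g x)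
    = a * (LINT x:\<Omega>|lebesgue. p x \<bullet> g x) + b * (LINT x:\<Omega>|lebesgue. q x \<bullet> g x)"
proof -
  have "set_integrable lebesgue \<Omega> (\<lambda>x. p x \<bullet> g x)" "set_integrable lebesgue \<Omega> (\<lambda>x. q x \<bullet> g x)"
    using assms by (simp_all add: L2_inner_integrable Omega_lmeasurable bounded_Omega)
  then show ?thesis
    by (simp add: scaleR_fun_def inner_add_left)
qed

lemma weak_divergence_lincomb:
  assumes "p \<in> L2 \<Omega>" "q \<in> L2 \<Omega>" "d \<in> L2 \<Omega>" "e \<in> L2 \<Omega>"
    and "weak_divergence \<Omega> p d" "weak_divergence \<Omega> q e"
  shows "weak_divergence \<Omega> (a *\<^sub>R p + b *\<^sub>R q) (a *\<^sub>R d + b *\<^sub>R e)"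
  unfolding weak_divergence_def
proof (intro allI impI)
  fix \<phi> g
  assume test: "C1_with_gradient \<phi> g \<and> (\<exists>K. compact K \<and> K \<subseteq> \<Omega> \<and> (\<forall>x. x \<notin> K \<longrightarrow> \<phi> x = 0))"
  then have cont: "continuous_on UNIV \<phi>" "continuous_on UNIV g"
    using C1_with_gradient_continuous by blast+
  have "(LINT x:\<Omega>|lebesgue. p x \<bullet> g x) = - (LINT x:\<Omega>|lebesgue. d x * \<phi> x)"
    "(LINT x:\<Omega>|lebesgue. q x \<bullet> g x) = - (LINT x:\<Omega>|lebesgue. e x * \<phi> x)"
    using assms(5,6) test unfolding weak_divergence_def by blast+
  then show "(LINT x:\<Omega>|lebesgue. (a *\<^sub>R p + b *\<^sub>R q) x \<bullet> g x)
      = - (LINT x:\<Omega>|lebesgue. (a *\<^sub>R d + b *\<^sub>R e) x * \<phi> x)"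
    using set_integral_lincomb[OF assms(1,2) cont(2), of a b]
      set_integral_lincomb[OF assms(3,4) cont(1), of a b]
    by (simp add: algebra_simps del: plus_fun_apply)
qed

lemma zero_normal_trace_lincomb:
  assumes "p \<in> L2 \<Omega>" "q \<in> L2 \<Omega>" "d \<in> L2 \<Omega>" "e \<in> L2 \<Omega>"
    and "zero_normal_trace \<Omega> p d" "zero_normal_trace \<Omega> q e"
  shows "zero_normal_trace \<Omega> (a *\<^sub>R p + b *\<^sub>R q) (a *\<^sub>R d + b *\<^sub>R e)"
  unfolding zero_normal_trace_def
proof (intro allI impI)
  fix \<phi> g
  assume test: "C1_with_gradient \<phi> g"
  then have cont: "continuous_on UNIV \<phi>" "continuous_on UNIV g"
    using C1_with_gradient_continuous by blast+
  have "(LINT x:\<Omega>|lebesgue. p x \<bullet> g x) = - (LINT x:\<Omega>|lebesgue. d x * \<phi> x)"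
    "(LINT x:\<Omega>|lebesgue. q x \<bullet> g x) = - (LINT x:\<Omega>|lebesgue. e x * \<phi> x)"
    using assms(5,6) test unfolding zero_normal_trace_def by (simp_all add: eq_neg_iff_add_eq_0)
  then show "(LINT x:\<Omega>|lebesgue. (a *\<^sub>R p + b *\<^sub>R q) x \<bullet> g x)
      + (LINT x:\<Omega>|lebesgue. (a *\<^sub>R d + b *\<^sub>R e) x * \<phi> x) = 0"
    using set_integral_lincomb[OF assms(1,2) cont(2), of a b]
      set_integral_lincomb[OF assms(3,4) cont(1), of a b]
    by (simp add: algebra_simps del: plus_fun_apply)
qed

lemma H0_div_lincomb:
  assumes "p \<in> H0_div \<Omega>" "q \<in> H0_div \<Omega>"
  shows "a *\<^sub>R p + b *\<^sub>R q \<in> H0_div \<Omega>"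
proof -
  obtain d e where de: "p \<in> L2 \<Omega>" "q \<in> L2 \<Omega>" "d \<in> L2 \<Omega>" "e \<in> L2 \<Omega>"
    "weak_divergence \<Omega> p d" "weak_divergence \<Omega> q e"
    "zero_normal_trace \<Omega> p d" "zero_normal_trace \<Omega> q e"
    using assms unfolding H0_div_def by blast
  moreover have "a *\<^sub>R p + b *\<^sub>R q \<in> L2 \<Omega>" "a *\<^sub>R d + b *\<^sub>R e \<in> L2 \<Omega>"
    using de by (intro subspace_add subspace_scale L2_subspace; simp)+
  ultimately show ?thesis
    unfolding H0_div_def
    using weak_divergence_lincomb[of p q d e a b] zero_normal_trace_lincomb[of p q d e a b] by blast
qed

lemma Yh_lincomb:
  assumes "p \<in> Yh m1 m2 h" "q \<in> Yh m1 m2 h"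
  shows "a *\<^sub>R p + b *\<^sub>R q \<in> Yh m1 m2 h"
proof -
  have "a *\<^sub>R p + b *\<^sub>R q \<in> H0_div \<Omega>"
    using assms by (intro H0_div_lincomb) (simp_all add: Yh_def)
  moreover have "a *\<^sub>R p + b *\<^sub>R q \<in> RT0 T" if "T \<in> Th m1 m2 h" for T
    using assms that by (intro subspace_add subspace_scale RT0_subspace) (simp_all add: Yh_def)
  moreover have "(a *\<^sub>R p + b *\<^sub>R q) x = 0" if "x \<notin> \<Union>(Th m1 m2 h)" for x
  proof -
    have "p x = 0" "q x = 0"
      using assms that unfolding Yh_def by blast+
    then show ?thesis by (simp add: scaleR_fun_def)
  qed
  ultimately show ?thesis
    unfolding Yh_def by blast
qed

lemma Yh_L2: "p \<in> Yh m1 m2 h \<Longrightarrow> p \<in> L2 \<Omega>"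
  by (simp add: Yh_def H0_div_def)

lemma Xh_subspace: "subspace (Xh m1 m2 h)"
proof (rule subspaceI)
  show "0 \<in> Xh m1 m2 h"
    by (simp add: Xh_def subspace_0[OF L2_subspace] constant_on_def)
next
  fix u v assume uv: "u \<in> Xh m1 m2 h" "v \<in> Xh m1 m2 h"
  have "u + v \<in> L2 \<Omega>"
    using uv by (intro subspace_add L2_subspace) (simp_all add: Xh_def)
  moreover have "(u + v) constant_on T" if "T \<in> Th m1 m2 h" for T
  proof -
    have "u constant_on T" "v constant_on T"
      using uv that by (simp_all add: Xh_def)
    then show ?thesis
      unfolding constant_on_def plus_fun_apply by metis
  qed
  moreover have "(u + v) x = 0" if "x \<notin> \<Union>(Th m1 m2 h)" for x
  proof -
    have "u x = 0" "v x = 0"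
      using uv that unfolding Xh_def by blast+
    then show ?thesis by simp
  qed
  ultimately show "u + v \<in> Xh m1 m2 h"
    unfolding Xh_def by blast
next
  fix c u assume u: "u \<in> Xh m1 m2 h"
  have "c *\<^sub>R u \<in> L2 \<Omega>"
    using u by (intro subspace_scale L2_subspace) (simp_all add: Xh_def)
  moreover have "(c *\<^sub>R u) constant_on T" if "T \<in> Th m1 m2 h" for T
  proof -
    have "u constant_on T"
      using u that by (simp add: Xh_def)
    then show ?thesis
      unfolding constant_on_def scaleR_fun_def by metis
  qed
  moreover have "(c *\<^sub>R u) x = 0" if "x \<notin> \<Union>(Th m1 m2 h)" for x
  proof -
    have "u x = 0"
      using u that unfolding Xh_def by blast
    then show ?thesis by (simp add: scaleR_fun_def)
  qed
  ultimately show "c *\<^sub>R u \<in> Xh m1 m2 h"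
    unfolding Xh_def by blast
qed

lemma elem_indicator_Xh:
  assumes "i < m1" "j < m2"
  shows "indicator (elem h i j) \<in> Xh m1 m2 h"
proof -
  have [measurable]: "elem h i j \<in> sets lebesgue" and "\<Omega> \<in> sets lebesgue"
    by (simp_all add: elem_eq_box Omega_eq_box)
  have "integrable lebesgue (indicat_real (elem h i j))"
    by (simp add: elem_eq_box integrable_indicator_iff emeasure_lborel_box_eq)
  moreover have "indicator \<Omega> x *\<^sub>R (norm (indicat_real (elem h i j) x))\<^sup>2 = indicat_real (elem h i j) x"
    "indicator \<Omega> x *\<^sub>R indicat_real (elem h i j) x = indicat_real (elem h i j) x" for x
    using elem_subset_Omega[OF assms] by (auto simp: indicator_def)
  ultimately have "indicat_real (elem h i j) \<in> L2 \<Omega>"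
    unfolding L2_def set_borel_measurable_def set_integrable_def mem_Collect_eq
    by (simp only: borel_measurable_integrable)
  moreover have "indicat_real (elem h i j) constant_on T" if "T \<in> Th m1 m2 h" for T
  proof -
    have "T = elem h i j \<or> T \<inter> elem h i j = {}"
      using that elem_unique unfolding Th_def by blast
    then show ?thesis
      by (auto simp: constant_on_def indicator_def)
  qed
  moreover have "indicat_real (elem h i j) x = 0" if "x \<notin> \<Union>(Th m1 m2 h)" for x
    using that assms by (auto simp: Th_def indicator_def)
  ultimately show ?thesis
    by (simp add: Xh_def)
qed

text \<open>Green's formula on single elements suggests \<open>d\<close>, but for a general test
  function it leaves edge integrals. They vanish once the test function is multiplied by the cutoff;
  then \<open>d\<close> and the weak divergence \<open>d'\<close> from \<open>H0_div\<close> have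
  equal integrals against it. As the cutoff tends to 1 this persists for the original test function,
  so \<open>d\<close> inherits the weak divergence property from \<open>d'\<close>.\<close>

lemma Yh_weak_divergence_exists:
  assumes p: "p \<in> Yh m1 m2 h"
  shows "\<exists>d\<in>Xh m1 m2 h. weak_divergence \<Omega> p d"
proof -
  have "\<forall>c\<in>cells. \<exists>a1 b1 a2 b2. \<forall>x\<in>elem h (fst c) (snd c). p x = (a1 + b1 * fst x, a2 + b2 * snd x)"
  proof
    fix c assume "c \<in> cells"
    then have "elem h (fst c) (snd c) \<in> Th m1 m2 h"
      by (intro elem_in_Th) auto
    with p have "p \<in> RT0 (elem h (fst c) (snd c))"
      unfolding Yh_def by blast
    then show "\<exists>a1 b1 a2 b2. \<forall>x\<in>elem h (fst c) (snd c). p x = (a1 + b1 * fst x, a2 + b2 * snd x)"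
      by (simp only: RT0_iff)
  qed
  then obtain A1 B1 A2 B2 where "\<forall>c\<in>cells. \<forall>x\<in>elem h (fst c) (snd c).
      p x = (A1 c + B1 c * fst x, A2 c + B2 c * snd x)"
    unfolding bchoice_iff by blast
  then have AB: "i < m1 \<Longrightarrow> j < m2 \<Longrightarrow> x \<in> elem h i j \<Longrightarrow>
      p x = (A1 (i, j) + B1 (i, j) * fst x, A2 (i, j) + B2 (i, j) * snd x)" for i j x
    by fastforce
  define d where "d = (\<Sum>c\<in>cells. (B1 c + B2 c) *\<^sub>R indicat_real (elem h (fst c) (snd c)))"
  have d_Xh: "d \<in> Xh m1 m2 h"
    unfolding d_def by (intro subspace_sum subspace_scale Xh_subspace elem_indicator_Xh) auto
  then have d_L2: "d \<in> L2 \<Omega>"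
    by (simp add: Xh_def)
  have d_elem: "d x = B1 (i, j) + B2 (i, j)" if "i < m1" "j < m2" "x \<in> elem h i j" for i j x
  proof -
    have "d x = (\<Sum>c\<in>cells. if c = (i, j) then B1 c + B2 c else 0)"
      unfolding d_def sum_fun_apply using that
      by (intro sum.cong) (auto simp: scaleR_fun_def indicator_def dest: elem_unique)
    also have "\<dots> = B1 (i, j) + B2 (i, j)"
      using that by (subst sum.delta) auto
    finally show ?thesis .
  qed
  obtain d' where d': "d' \<in> L2 \<Omega>" "weak_divergence \<Omega> p d'"
    using p unfolding Yh_def H0_div_def by blast
  have "weak_divergence \<Omega> p d"
    unfolding weak_divergence_def
  proof (intro allI impI, elim conjE exE)
    fix \<phi> g K
    assume C1: "C1_with_gradient \<phi> g" and K: "compact K" "K \<subseteq> \<Omega>" "\<forall>x. x \<notin> K \<longrightarrow> \<phi> x = 0"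
    have "(LINT x:\<Omega>|lebesgue. d' x * (cutoff n x * \<phi> x)) = (LINT x:\<Omega>|lebesgue. d x * (cutoff n x * \<phi> x))" for n
    proof -
      let ?\<psi> = "\<lambda>x. cutoff n x * \<phi> x"
      obtain g' where g': "C1_with_gradient ?\<psi> g'"
        using C1_with_gradient_mult[OF _ C1] C1_cutoff by blast
      note cont = C1_with_gradient_continuous[OF g']
      have ints: "set_integrable lebesgue \<Omega> (\<lambda>x. p x \<bullet> g' x)" "set_integrable lebesgue \<Omega> (\<lambda>x. d x * ?\<psi> x)"
        using L2_inner_integrable[OF Yh_L2[OF p] Omega_lmeasurable bounded_Omega cont(2)]
          L2_inner_integrable[OF d_L2 Omega_lmeasurable bounded_Omega cont(1)] by simp_all
      have "(LINT x:elem h i j|lebesgue. p x \<bullet> g' x + d x * ?\<psi> x) = 0" if ij: "i < m1" "j < m2" for i j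
      proof -
        have "(LINT x:elem h i j|lebesgue. p x \<bullet> g' x + d x * ?\<psi> x)
            = (LINT x:elem h i j|lebesgue. (A1 (i, j) + B1 (i, j) * fst x, A2 (i, j) + B2 (i, j) * snd x) \<bullet> g' x
                + (B1 (i, j) + B2 (i, j)) * ?\<psi> x)"
          using AB[OF ij] d_elem[OF ij] by (intro set_lebesgue_integral_cong) (auto simp: elem_eq_box)
        also have "\<dots> = 0"
          unfolding elem_eq_box
          by (intro box_green_RT0[OF g']) (use h in \<open>simp_all only: cutoff_grid mult_zero_left, simp_all\<close>)
        finally show ?thesis .
      qed
      then have "(LINT x:\<Omega>|lebesgue. p x \<bullet> g' x + d x * ?\<psi> x) = 0"
        using ints by (subst set_integral_Omega) (auto intro!: sum.neutral)
      then have "(LINT x:\<Omega>|lebesgue. p x \<bullet> g' x) + (LINT x:\<Omega>|lebesgue. d x * ?\<psi> x) = 0"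
        using ints by simp
      moreover have "(LINT x:\<Omega>|lebesgue. p x \<bullet> g' x) = - (LINT x:\<Omega>|lebesgue. d' x * ?\<psi> x)"
      proof -
        \<comment> \<open>Multiplication by the cutoff keeps the support in \<open>K\<close>, so
          \<open>?\<psi>\<close> is admissible in the definition of
          \<open>weak_divergence\<close>.\<close>
        have "\<forall>x. x \<notin> K \<longrightarrow> ?\<psi> x = 0"
          using K by simp
        with d'(2) g' K show ?thesis
          unfolding weak_divergence_def by blast
      qed
      ultimately show ?thesis by simp
    qed
    then have "(\<lambda>n. LINT x:\<Omega>|lebesgue. d x * (cutoff n x * \<phi> x)) \<longlonglongrightarrow> (LINT x:\<Omega>|lebesgue. d' x * \<phi> x)"
      using set_integral_cutoff_tendsto[OF d'(1) C1_with_gradient_continuous(1)[OF C1]] by simp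
    then have "(LINT x:\<Omega>|lebesgue. d' x * \<phi> x) = (LINT x:\<Omega>|lebesgue. d x * \<phi> x)"
      using set_integral_cutoff_tendsto[OF d_L2 C1_with_gradient_continuous(1)[OF C1]] LIMSEQ_unique by blast
    moreover have "(LINT x:\<Omega>|lebesgue. p x \<bullet> g x) = - (LINT x:\<Omega>|lebesgue. d' x * \<phi> x)"
      using d'(2) C1 K unfolding weak_divergence_def by blast
    ultimately show "(LINT x:\<Omega>|lebesgue. p x \<bullet> g x) = - (LINT x:\<Omega>|lebesgue. d x * \<phi> x)"
      by simp
  qed
  with d_Xh show ?thesis by blast
qed

text \<open>A bump supported inside one element isolates the constant value there: both candidates,
  multiplied by its nonzero integral, give the same number.\<close>

lemma Xh_weak_divergence_unique:
  assumes d: "d \<in> Xh m1 m2 h" "weak_divergence \<Omega> p d" and e: "e \<in> Xh m1 m2 h" "weak_divergence \<Omega> p e"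
  shows "d = e"
proof
  fix c
  show "d c = e c"
  proof (cases "c \<in> \<Union>(Th m1 m2 h)")
    case False
    then have "d c = 0" "e c = 0"
      using d e unfolding Xh_def by blast+
    then show ?thesis by simp
  next
    case True
    then obtain i j where ij: "i < m1" "j < m2" and c: "c \<in> elem h i j"
      by (auto simp: Th_def)
    \<comment> \<open>The closed ball is the compact support required of test functions.\<close>
    obtain r where r: "r > 0" "cball c r \<subseteq> elem h i j"
      using open_elem[of i j] c unfolding open_contains_cball by blast
    define \<phi> where "\<phi> x = (max 0 (r\<^sup>2 - (dist c x)\<^sup>2))\<^sup>2" for x
    obtain g where C1: "C1_with_gradient \<phi> g"
      using C1_bump unfolding \<phi>_def by blast
    have zero: "\<phi> x = 0" if "x \<notin> cball c r" for x
      using that r power_mono[of r "dist c x" 2] by (simp add: \<phi>_def)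
    have pos: "\<phi> x > 0" if "x \<in> ball c r" for x
      using that r power_strict_mono[of "dist c x" r 2] by (simp add: \<phi>_def)
    have const: "u x * \<phi> x = u c * \<phi> x" if "u \<in> Xh m1 m2 h" for u x
    proof (cases "x \<in> cball c r")
      case True
      have "u constant_on elem h i j"
        using that ij by (auto simp: Xh_def Th_def)
      then have "u x = u c"
        using c r True unfolding constant_on_def by (metis subsetD)
      then show ?thesis by simp
    qed (simp add: zero)
    have sub: "cball c r \<subseteq> \<Omega>"
      using r elem_subset_Omega[OF ij] by auto
    then have test: "\<exists>K. compact K \<and> K \<subseteq> \<Omega> \<and> (\<forall>x. x \<notin> K \<longrightarrow> \<phi> x = 0)"
      using zero compact_cball by blast
    have "(LINT x:\<Omega>|lebesgue. p x \<bullet> g x) = - (u c * (LINT x:\<Omega>|lebesgue. \<phi> x))"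
      if u: "u \<in> Xh m1 m2 h" "weak_divergence \<Omega> p u" for u
    proof -
      have "(\<lambda>x. u x * \<phi> x) = (\<lambda>x. u c * \<phi> x)"
        by (rule ext) (rule const[OF u(1)])
      moreover have "(LINT x:\<Omega>|lebesgue. p x \<bullet> g x) = - (LINT x:\<Omega>|lebesgue. u x * \<phi> x)"
        using u(2) C1 test unfolding weak_divergence_def by blast
      ultimately show ?thesis by simp
    qed
    from this[OF d] this[OF e] have eq: "d c * (LINT x:\<Omega>|lebesgue. \<phi> x) = e c * (LINT x:\<Omega>|lebesgue. \<phi> x)"
      by linarith
    have ind: "indicat_real \<Omega> x *\<^sub>R \<phi> x = \<phi> x" for x
    proof (cases "x \<in> cball c r")
      case True
      with sub have "x \<in> \<Omega>" by blast
      then show ?thesis by simp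
    qed (simp add: zero)
    then have \<phi>_int: "(LINT x:\<Omega>|lebesgue. \<phi> x) = (LINT x|lebesgue. \<phi> x)"
      by (simp only: set_lebesgue_integral_def ind)
    \<comment> \<open>Otherwise the nonnegative \<phi> would vanish almost everywhere, although it
      is positive on an open ball.\<close>
    have "(LINT x:\<Omega>|lebesgue. \<phi> x) \<noteq> 0"
    proof
      assume "(LINT x:\<Omega>|lebesgue. \<phi> x) = 0"
      moreover have "set_integrable lebesgue \<Omega> \<phi>"
      proof -
        have "set_integrable lebesgue (cbox (0, 0) (real m1 * h, real m2 * h)) \<phi>"
          by (rule absolutely_integrable_continuous, rule continuous_on_subset)
            (rule C1_with_gradient_continuous(1)[OF C1], simp)
        then show ?thesis
          unfolding Omega_eq_box by (rule set_integrable_subset) (auto simp: box_subset_cbox)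
      qed
      then have "integrable lebesgue \<phi>"
        by (simp only: set_integrable_def ind)
      moreover have "AE x in lebesgue. 0 \<le> \<phi> x"
        by (simp add: \<phi>_def)
      ultimately have "AE x in lebesgue. \<phi> x = 0"
        using integral_nonneg_eq_0_iff_AE \<phi>_int by metis
      then have "AE x in lebesgue. x \<notin> ball c r"
        by (rule eventually_mono) (use pos in force)
      then have "negligible (ball c r)"
        unfolding negligible_iff_null_sets by (subst AE_iff_null_sets) auto
      then show False
        using r by (simp add: open_not_negligible)
    qed
    with eq show ?thesis by simp
  qed
qed

lemma div_h:
  assumes "p \<in> Yh m1 m2 h"
  shows "div_h m1 m2 h p \<in> Xh m1 m2 h" "weak_divergence \<Omega> p (div_h m1 m2 h p)"
proof -
  have "\<exists>!d. d \<in> Xh m1 m2 h \<and> weak_divergence \<Omega> p d"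
    using Yh_weak_divergence_exists[OF assms] Xh_weak_divergence_unique by blast
  from theI'[OF this] show "div_h m1 m2 h p \<in> Xh m1 m2 h" "weak_divergence \<Omega> p (div_h m1 m2 h p)"
    unfolding div_h_def by auto
qed

text \<open>\<open>div_h\<close> is a definite description, so linearity comes from uniqueness: both
  sides lie in \<open>Xh\<close> and are weak divergences of the same field.\<close>

lemma div_h_lincomb:
  assumes p: "p \<in> Yh m1 m2 h" and q: "q \<in> Yh m1 m2 h"
  shows "div_h m1 m2 h (a *\<^sub>R p + b *\<^sub>R q) = a *\<^sub>R div_h m1 m2 h p + b *\<^sub>R div_h m1 m2 h q"
proof (rule Xh_weak_divergence_unique)
  show "div_h m1 m2 h (a *\<^sub>R p + b *\<^sub>R q) \<in> Xh m1 m2 h"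
    "weak_divergence \<Omega> (a *\<^sub>R p + b *\<^sub>R q) (div_h m1 m2 h (a *\<^sub>R p + b *\<^sub>R q))"
    using Yh_lincomb[OF p q] by (rule div_h)+
  show "a *\<^sub>R div_h m1 m2 h p + b *\<^sub>R div_h m1 m2 h q \<in> Xh m1 m2 h"
    using div_h[OF p] div_h[OF q] by (intro subspace_add subspace_scale Xh_subspace) auto
  show "weak_divergence \<Omega> (a *\<^sub>R p + b *\<^sub>R q) (a *\<^sub>R div_h m1 m2 h p + b *\<^sub>R div_h m1 m2 h q)"
    using div_h[OF p] div_h[OF q] Yh_L2[OF p] Yh_L2[OF q]
    by (intro weak_divergence_lincomb) (auto simp: Xh_def)
qed

section \<open>Edge values and the constraint set\<close>

lemma edge_val_affine:
  assumes "\<And>x. x \<in> elem h i j \<Longrightarrow> p x = (a1 + b1 * fst x, a2 + b2 * snd x)"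
  shows "edge_val h p (Vert i j) = a1 + b1 * (real (i + 1) * h)"
    "edge_val h p (Horiz i j) = a2 + b2 * (real (j + 1) * h)"
proof -
  have "closure (elem h i j) = cbox (real i * h, real j * h) (real (i + 1) * h, real (j + 1) * h)"
    using elem_nonempty[of i j] unfolding elem_eq_box by (rule closure_box)
  moreover have "real i * h \<le> real (i + 1) * h" "real j * h \<le> real (j + 1) * h"
    using h by (intro mult_right_mono; simp)+
  ultimately have cl: "s \<in> {real j * h..real (j + 1) * h} \<Longrightarrow> (real (i + 1) * h, s) \<in> closure (elem h i j)"
    "s \<in> {real i * h..real (i + 1) * h} \<Longrightarrow> (s, real (j + 1) * h) \<in> closure (elem h i j)" for s
    by (simp_all del: of_nat_add of_nat_Suc)
  have tr: "trace_from (elem h i j) p z = (a1 + b1 * fst z, a2 + b2 * snd z)"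
    if "z \<in> closure (elem h i j)" for z
  by (rule trace_from_eq[OF open_elem that assms]) (auto intro!: continuous_intros)
  \<comment> \<open>The normal component depends only on the coordinate that is fixed along the
    edge, so its mean is that constant value.\<close>
  have "integral {real j * h..real (j + 1) * h} (\<lambda>s. trace_from (elem h i j) p (real (i + 1) * h, s) \<bullet> (1, 0))
      = integral {real j * h..real (j + 1) * h} (\<lambda>s. a1 + b1 * (real (i + 1) * h))"
    by (rule integral_cong) (simp only: tr[OF cl(1)], simp)
  then show "edge_val h p (Vert i j) = a1 + b1 * (real (i + 1) * h)"
    using h by (simp add: field_simps)
  have "integral {real i * h..real (i + 1) * h} (\<lambda>s. trace_from (elem h i j) p (s, real (j + 1) * h) \<bullet> (0, 1))
      = integral {real i * h..real (i + 1) * h} (\<lambda>s. a2 + b2 * (real (j + 1) * h))"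
    by (rule integral_cong) (simp only: tr[OF cl(2)], simp)
  then show "edge_val h p (Horiz i j) = a2 + b2 * (real (j + 1) * h)"
    using h by (simp add: field_simps)
qed

text \<open>\<open>trace_from\<close> is a \<open>Lim\<close>, hence linear only where limits exist;
  linearity is therefore read off from the affine coefficients on the element from which the trace
  is taken.\<close>

lemma edge_val_lincomb:
  assumes p: "p \<in> Yh m1 m2 h" and q: "q \<in> Yh m1 m2 h" and e: "e \<in> Eh m1 m2"
  shows "edge_val h (a *\<^sub>R p + b *\<^sub>R q) e = a * edge_val h p e + b * edge_val h q e"
proof -
  obtain i j where ij: "i < m1" "j < m2" and e: "e = Vert i j \<or> e = Horiz i j"
    using e by (auto simp: Eh_def)
  then have "p \<in> RT0 (elem h i j)" "q \<in> RT0 (elem h i j)"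
    using p q unfolding Yh_def Th_def by blast+
  then obtain a1 b1 a2 b2 a1' b1' a2' b2' where
    p': "\<And>x. x \<in> elem h i j \<Longrightarrow> p x = (a1 + b1 * fst x, a2 + b2 * snd x)" and
    q': "\<And>x. x \<in> elem h i j \<Longrightarrow> q x = (a1' + b1' * fst x, a2' + b2' * snd x)"
    unfolding RT0_iff by metis
  have pq: "(a *\<^sub>R p + b *\<^sub>R q) x
      = ((a * a1 + b * a1') + (a * b1 + b * b1') * fst x, (a * a2 + b * a2') + (a * b2 + b * b2') * snd x)"
    if "x \<in> elem h i j" for x
    using p'[OF that] q'[OF that] by (simp add: scaleR_fun_def algebra_simps)
  show ?thesis
    using e edge_val_affine[of i j, OF p'] edge_val_affine[of i j, OF q'] edge_val_affine[of i j "a *\<^sub>R p + b *\<^sub>R q", OF pq]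
    by (auto simp: algebra_simps simp del: edge_val.simps)
qed

text \<open>Every interior edge is the right or the upper edge of exactly one element.\<close>

lemma card_Eh: "finite (Eh m1 m2)" "real (card (Eh m1 m2)) \<le> 2 * (real m1 * real m2)"
proof -
  let ?V = "case_prod Vert ` cells" and ?H = "case_prod Horiz ` cells"
  have sub: "Eh m1 m2 \<subseteq> ?V \<union> ?H"
    by (auto simp: Eh_def)
  then show "finite (Eh m1 m2)"
    by (rule finite_subset) simp
  have "card (Eh m1 m2) \<le> card (?V \<union> ?H)"
    using sub by (intro card_mono) auto
  also have "\<dots> \<le> card ?V + card ?H"
    by (rule card_Un_le)
  also have "\<dots> \<le> card cells + card cells"
    by (intro add_mono card_image_le) auto
  finally have "card (Eh m1 m2) \<le> 2 * (m1 * m2)"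
    by simp
  then show "real (card (Eh m1 m2)) \<le> 2 * (real m1 * real m2)"
    by (metis of_nat_le_iff of_nat_mult of_nat_numeral)
qed

lemma Cset_convex:
  assumes "p \<in> Cset m1 m2 h" "q \<in> Cset m1 m2 h" "a \<ge> 0" "b \<ge> 0" "a + b = 1"
  shows "a *\<^sub>R p + b *\<^sub>R q \<in> Cset m1 m2 h"
proof -
  have Y: "p \<in> Yh m1 m2 h" "q \<in> Yh m1 m2 h"
    using assms by (auto simp: Cset_def)
  have "\<bar>edge_val h (a *\<^sub>R p + b *\<^sub>R q) e\<bar> \<le> 1" if e: "e \<in> Eh m1 m2" for e
  proof -
    have "\<bar>a * edge_val h p e + b * edge_val h q e\<bar> \<le> a * \<bar>edge_val h p e\<bar> + b * \<bar>edge_val h q e\<bar>"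
      using assms(3,4) abs_triangle_ineq[of "a * edge_val h p e" "b * edge_val h q e"]
      by (simp add: abs_mult)
    also have "\<dots> \<le> a * 1 + b * 1"
      using assms e by (intro add_mono mult_left_mono) (auto simp: Cset_def)
    finally show ?thesis
      using assms(5) by (simp add: edge_val_lincomb[OF Y e])
  qed
  with Yh_lincomb[OF Y] show ?thesis
    by (simp add: Cset_def)
qed

text \<open>The factor 8 is 2 squared, from edge values in [-1, 1], times two edges per element;
  each element has area \<open>h\<^sup>2\<close>.\<close>

lemma norm_Y_diff_Cset:
  assumes "p \<in> Cset m1 m2 h" "q \<in> Cset m1 m2 h"
  shows "(norm_Y m1 m2 h (p - q))\<^sup>2 \<le> 8 * measure lebesgue \<Omega>"
proof -
  have Y: "p \<in> Yh m1 m2 h" "q \<in> Yh m1 m2 h"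
    using assms by (auto simp: Cset_def)
  have "(norm_Y m1 m2 h (p - q))\<^sup>2 = h\<^sup>2 * (\<Sum>e\<in>Eh m1 m2. (edge_val h (p - q) e)\<^sup>2)"
    by (simp add: norm_Y_def inner_Y_def power2_eq_square sum_nonneg)
  also have "\<dots> \<le> h\<^sup>2 * (\<Sum>e\<in>Eh m1 m2. 4)"
  proof (intro mult_left_mono sum_mono)
    fix e assume e: "e \<in> Eh m1 m2"
    have "edge_val h (p - q) e = edge_val h p e - edge_val h q e"
      using edge_val_lincomb[OF Y e, of 1 "-1"] by simp
    moreover have "\<bar>edge_val h p e\<bar> \<le> 1" "\<bar>edge_val h q e\<bar> \<le> 1"
      using assms e by (auto simp: Cset_def)
    ultimately have "\<bar>edge_val h (p - q) e\<bar> \<le> 2"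
      by linarith
    then show "(edge_val h (p - q) e)\<^sup>2 \<le> 4"
      using power_mono[of "\<bar>edge_val h (p - q) e\<bar>" 2 2] by simp
  qed simp
  also have "\<dots> = 4 * h\<^sup>2 * real (card (Eh m1 m2))"
    by simp
  also have "\<dots> \<le> 4 * h\<^sup>2 * (2 * (real m1 * real m2))"
    using card_Eh(2) by (intro mult_left_mono) auto
  finally show ?thesis
    by (simp add: measure_Omega)
qed

text \<open>
  Unlike \<open>inner_X\<close>, whose \<open>elem_val\<close> is junk on functions that are not elementwise constant, this
  form is bilinear on all functions.
\<close>

definition ip :: "(point \<Rightarrow> real) \<Rightarrow> (point \<Rightarrow> real) \<Rightarrow> real"
  where "ip u v = h\<^sup>2 * (\<Sum>T\<in>Th m1 m2 h. u (SOME x. x \<in> T) * v (SOME x. x \<in> T))"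

lemma elem_val_Xh:
  assumes u: "u \<in> Xh m1 m2 h" and T: "T \<in> Th m1 m2 h"
  shows "elem_val u T = u (SOME x. x \<in> T)"
proof -
  have "T \<noteq> {}"
    using T elem_nonempty by (auto simp: Th_def)
  then have x: "(SOME x. x \<in> T) \<in> T"
    by (simp add: some_in_eq)
  obtain c where c: "\<And>x. x \<in> T \<Longrightarrow> u x = c"
    using u T unfolding Xh_def constant_on_def by blast
  have "elem_val u T = c"
    unfolding elem_val_def
  proof (rule the_equality)
    show "\<forall>x\<in>T. u x = c"
      using c by (rule ballI)
    show "c' = c" if "\<forall>x\<in>T. u x = c'" for c'
      using bspec[OF that x] c[OF x] by simp
  qed
  with c[OF x] show ?thesis by simp
qed

lemma inner_X_eq_ip:
  "u \<in> Xh m1 m2 h \<Longrightarrow> v \<in> Xh m1 m2 h \<Longrightarrow> inner_X m1 m2 h u v = ip u v"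
  by (simp add: inner_X_def ip_def elem_val_Xh)

end

sublocale mesh \<subseteq> semi_inner ip
proof
  show "bilinear ip"
    unfolding bilinear_def
    by (auto intro!: linearI simp: ip_def scaleR_fun_def sum.distrib distrib_left distrib_right
        sum_distrib_left mult_ac)
  show "ip u v = ip v u" for u v
    by (simp add: ip_def mult.commute)
  show "0 \<le> ip u u" for u
    by (simp add: ip_def sum_nonneg)
qed

section \<open>Sums of corrections and relaxed steps\<close>

context mesh
begin

lemma norm_X_eq_nrm: "u \<in> Xh m1 m2 h \<Longrightarrow> norm_X m1 m2 h u = nrm u"
  by (simp add: norm_X_def nrm_def inner_X_eq_ip)

lemma Yh_scale: "p \<in> Yh m1 m2 h \<Longrightarrow> a *\<^sub>R p \<in> Yh m1 m2 h"
  using Yh_lincomb[of p p a 0] by simp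

lemma Yh_add: "p \<in> Yh m1 m2 h \<Longrightarrow> q \<in> Yh m1 m2 h \<Longrightarrow> p + q \<in> Yh m1 m2 h"
  using Yh_lincomb[of p q 1 1] by simp

lemma div_h_add_scale:
  assumes "p \<in> Yh m1 m2 h" "q \<in> Yh m1 m2 h"
  shows "div_h m1 m2 h (p + a *\<^sub>R q) = div_h m1 m2 h p + a *\<^sub>R div_h m1 m2 h q"
  using div_h_lincomb[OF assms, of 1 a] by simp

text \<open>Membership is carried through the induction because additivity of \<open>div_h\<close>
  is available only when the partial sum lies in \<open>Yh\<close>.\<close>

lemma div_h_sum:
  assumes "finite A" "A \<noteq> {}" "\<And>k. k \<in> A \<Longrightarrow> f k \<in> Yh m1 m2 h"
  shows "(\<Sum>k\<in>A. f k) \<in> Yh m1 m2 h \<and> div_h m1 m2 h (\<Sum>k\<in>A. f k) = (\<Sum>k\<in>A. div_h m1 m2 h (f k))"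
  using assms
proof (induction rule: finite_ne_induct)
  case (insert k A)
  then have f: "f k \<in> Yh m1 m2 h" "(\<Sum>k\<in>A. f k) \<in> Yh m1 m2 h"
    and IH: "div_h m1 m2 h (\<Sum>k\<in>A. f k) = (\<Sum>k\<in>A. div_h m1 m2 h (f k))"
    by auto
  show ?case
    using Yh_add[OF f] div_h_add_scale[OF f, of 1]
    unfolding sum.insert[OF insert.hyps(1,3)] scaleR_one IH by (rule conjI)
qed simp

lemma convex_Cset: "convex (Cset m1 m2 h)"
  unfolding convex_def using Cset_convex by blast

text \<open>The new point is a convex combination of \<open>p\<close>, with weight
  \<open>1 - \<tau> * card A\<close>, and the mean of the points \<open>p + r k\<close>.\<close>

lemma Cset_relaxed_step:
  fixes \<tau> :: real
  assumes p: "p \<in> Cset m1 m2 h" and r: "\<And>k. k \<in> A \<Longrightarrow> p + r k \<in> Cset m1 m2 h"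
    and A: "finite A" "A \<noteq> {}" and \<tau>: "0 \<le> \<tau>" "\<tau> * card A \<le> 1"
  shows "p + \<tau> *\<^sub>R (\<Sum>k\<in>A. r k) \<in> Cset m1 m2 h"
proof -
  define q where "q = (\<Sum>k\<in>A. (1 / card A) *\<^sub>R (p + r k))"
  have q: "q \<in> Cset m1 m2 h"
    unfolding q_def using A r by (intro convex_sum convex_Cset) auto
  have "q = p + (1 / card A) *\<^sub>R (\<Sum>k\<in>A. r k)"
    using A by (simp add: q_def scaleR_add_right sum.distrib scaleR_sum_right sum_constant_scaleR)
  then have "p + \<tau> *\<^sub>R (\<Sum>k\<in>A. r k) = (1 - \<tau> * card A) *\<^sub>R p + (\<tau> * card A) *\<^sub>R q"
    using A by (simp add: algebra_simps)
  also have "\<dots> \<in> Cset m1 m2 h"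
    using \<tau> by (intro Cset_convex p q) auto
  finally show ?thesis .
qed

end


subsection \<open>Convergence of the additive Schwarz method\<close>

text \<open>Expanding the square gives
  \<open>S\<^sup>2 = c1 + (c1 + 1 / \<kappa>\<^sup>2) + 2 * Q\<close>. Each upper bound keeps one of
  the positive contributions \<open>1 / \<kappa>\<^sup>2\<close>, \<open>c1\<close> or
  \<open>Q\<close>; for the last two, \<open>\<kappa> \<le> \<kappa>\<^sup>2\<close> trades one
  factor \<kappa>.\<close>

lemma schwarz_rate:
  fixes \<kappa> c1 c2 V :: real
  assumes \<kappa>: "\<kappa> \<ge> 1" and c1: "c1 > 0"
  defines "\<rho> \<equiv> 1 / (\<kappa>\<^sup>2 * (sqrt c1 + sqrt (c1 + 1 / \<kappa>\<^sup>2))\<^sup>2)"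
  shows "0 < \<rho>" "\<rho> \<le> 1" "\<rho> * c1 \<le> 1 / \<kappa>" "\<rho> \<le> 1 / (\<kappa> * sqrt (c1 * (c1 + 1 / \<kappa>\<^sup>2)))"
proof -
  define S where "S = sqrt c1 + sqrt (c1 + 1 / \<kappa>\<^sup>2)"
  define Q where "Q = sqrt (c1 * (c1 + 1 / \<kappa>\<^sup>2))"
  have c1': "c1 + 1 / \<kappa>\<^sup>2 > 0"
    using c1 \<kappa> by (simp add: add_pos_nonneg)
  have Q: "Q > 0"
    using c1 c1' by (simp add: Q_def)
  have S: "S > 0"
    using c1 c1' by (simp add: S_def add_pos_pos)
  have S2: "S\<^sup>2 = c1 + (c1 + 1 / \<kappa>\<^sup>2) + 2 * Q"
    using c1 c1' by (simp add: S_def Q_def power2_sum real_sqrt_mult)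
  have \<rho>: "\<rho> = 1 / (\<kappa>\<^sup>2 * S\<^sup>2)"
    by (simp add: \<rho>_def S_def)
  show pos: "0 < \<rho>"
    using \<kappa> S by (simp add: \<rho>)
  have "\<kappa>\<^sup>2 * (1 / \<kappa>\<^sup>2) \<le> \<kappa>\<^sup>2 * S\<^sup>2"
    using c1 Q by (intro mult_left_mono) (simp_all add: S2)
  then have "1 \<le> \<kappa>\<^sup>2 * S\<^sup>2"
    using \<kappa> by simp
  then show "\<rho> \<le> 1"
    by (simp add: \<rho>)
  have \<kappa>2: "\<kappa> \<le> \<kappa>\<^sup>2"
    using \<kappa> by (simp add: power2_eq_square)
  have "c1 \<le> S\<^sup>2"
    using c1 c1' Q unfolding S2 by linarith
  then have "\<kappa> * c1 \<le> \<kappa>\<^sup>2 * S\<^sup>2"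
    using \<kappa>2 \<kappa> c1 by (intro mult_mono) auto
  then show "\<rho> * c1 \<le> 1 / \<kappa>"
    using \<kappa> S by (simp add: \<rho> field_simps)
  have "Q \<le> S\<^sup>2"
    using c1 c1' Q unfolding S2 by linarith
  then have "\<kappa> * Q \<le> \<kappa>\<^sup>2 * S\<^sup>2"
    using \<kappa>2 \<kappa> Q by (intro mult_mono) auto
  then show "\<rho> \<le> 1 / (\<kappa> * sqrt (c1 * (c1 + 1 / \<kappa>\<^sup>2)))"
    using \<kappa> S Q unfolding \<rho> Q_def[symmetric] by (intro divide_left_mono) auto
qed

text \<open>\<open>M\<close> is the fixed point of the recursion, so the excess over
  \<open>M\<close> is multiplied by at most \<open>1 - a\<close>, which is nonnegative.\<close>

lemma affine_recursion_bound:
  fixes x :: "nat \<Rightarrow> real"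
  assumes "\<And>n. x (Suc n) \<le> (1 - a) * x n + a * M" "a \<le> 1"
  shows "x n \<le> (1 - a) ^ n * (x 0 - M) + M"
proof (induction n)
  case (Suc n)
  have "x (Suc n) \<le> (1 - a) * x n + a * M"
    by fact
  also have "\<dots> \<le> (1 - a) * ((1 - a) ^ n * (x 0 - M) + M) + a * M"
    using Suc assms(2) by (intro add_right_mono mult_left_mono) auto
  finally show ?case
    by (simp add: algebra_simps)
qed simp

locale dual_mesh = mesh m1 m2 h + smooth_strongly_convex "mesh.ip m1 m2 h" "Xh m1 m2 h" F F' \<alpha> \<beta>
  for m1 m2 :: nat and h :: real and F F' \<alpha> \<beta>
begin

lemma dual_energy_eq:
  assumes "p \<in> Yh m1 m2 h"
  shows "dual_energy m1 m2 h F p = conjugate (div_h m1 m2 h p)"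
  unfolding dual_energy_def conjugate_X_def conjugate_def
  using div_h(1)[OF assms] by (intro SUP_cong) (simp_all add: inner_X_eq_ip)

lemma alpha_le_beta_mesh:
  assumes "m1 \<ge> 1" "m2 \<ge> 1"
  shows "\<alpha> \<le> \<beta>"
proof -
  let ?u = "indicat_real (elem h 0 0)"
  have T: "elem h 0 0 \<in> Th m1 m2 h"
    using assms by (intro elem_in_Th) auto
  have "0 < (?u (SOME x. x \<in> elem h 0 0))\<^sup>2"
    using elem_nonempty[of 0 0] by (simp add: some_in_eq)
  also have "\<dots> \<le> (\<Sum>T\<in>Th m1 m2 h. (?u (SOME x. x \<in> T))\<^sup>2)"
    using T finite_Th by (intro member_le_sum) auto
  finally have "ip ?u ?u > 0"
    using h by (simp add: ip_def power2_eq_square)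
  then have "nrm ?u > 0"
    by (simp add: nrm_def)
  then show ?thesis
    by (rule alpha_le_beta[rotated]) (use assms in \<open>intro elem_indicator_Xh; simp\<close>)
qed

text \<open>The step length \<rho> is left free within its three constraints; the explicit rate is
  inserted only in the theorem. Membership of \<open>p'\<close> is part of the conclusion so that
  the step can be iterated.\<close>

lemma additive_schwarz_step:
  assumes m: "m1 \<ge> 1" "m2 \<ge> 1" and \<kappa>_def: "\<kappa> = \<beta> / \<alpha>"
    and N: "N \<ge> 1" and W: "space_decomposition m1 m2 h N W"
    and c: "c1 > 0" "c2 \<ge> 0" and stable: "stable_decomposition m1 m2 h N W c1 c2"
    and \<tau>: "0 < \<tau>" "\<tau> \<le> 1 / real N"
    and p: "p \<in> Cset m1 m2 h" and pstar: "pstar \<in> Cset m1 m2 h"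
    and r: "\<And>k. k \<in> {1..N} \<Longrightarrow> is_arg_min (\<lambda>s. dual_energy m1 m2 h F (p + s))
                       (\<lambda>s. s \<in> W k \<and> p + s \<in> Cset m1 m2 h) (r k)"
    and \<rho>: "0 < \<rho>" "\<rho> \<le> 1" "\<rho> * c1 \<le> 1 / \<kappa>"
  defines "E \<equiv> dual_energy m1 m2 h F" and "p' \<equiv> p + \<tau> *\<^sub>R (\<Sum>k=1..N. r k)"
  shows "p' \<in> Cset m1 m2 h"
    and "\<alpha> * (E p' - E pstar) \<le> (1 - \<tau> * \<rho>) * (\<alpha> * (E p - E pstar))
      + \<tau> * \<rho> * (4 * c2 * measure lebesgue \<Omega> * \<rho>)"
proof -
  let ?K = "{1..N}" and ?div = "div_h m1 m2 h" and ?V = "measure lebesgue \<Omega>"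
  have K: "finite ?K" "?K \<noteq> {}"
    using N by auto
  have \<tau>N: "\<tau> * card ?K \<le> 1"
    using \<tau> N by (simp add: field_simps)
  have CY: "q \<in> Yh m1 m2 h" if "q \<in> Cset m1 m2 h" for q
    using that by (simp add: Cset_def)
  have W_sub: "subspace (W k)" "W k \<subseteq> Yh m1 m2 h" if "k \<in> ?K" for k
    using W that unfolding space_decomposition_def by blast+
  have WY: "s \<in> Yh m1 m2 h" and W_scale: "a *\<^sub>R s \<in> W k" if "k \<in> ?K" "s \<in> W k" for k s a
    using W_sub[OF that(1)] that(2) by (auto intro: subspace_scale)
  have rW: "r k \<in> W k" and rC: "p + r k \<in> Cset m1 m2 h"
    and r_min: "s \<in> W k \<Longrightarrow> p + s \<in> Cset m1 m2 h \<Longrightarrow> E (p + r k) \<le> E (p + s)" if "k \<in> ?K" for k s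
    using r[OF that] unfolding is_arg_min_def E_def by (auto simp: not_less)
  show p': "p' \<in> Cset m1 m2 h"
    unfolding p'_def using p rC K \<tau> \<tau>N by (intro Cset_relaxed_step) auto
  obtain t where tW: "\<And>k. k \<in> ?K \<Longrightarrow> t k \<in> W k" and t_sum: "pstar - p = (\<Sum>k=1..N. t k)"
    and tC: "\<And>k. k \<in> ?K \<Longrightarrow> p + t k \<in> Cset m1 m2 h"
    and t_bound: "(\<Sum>k=1..N. (norm_X m1 m2 h (?div (t k)))\<^sup>2)
         \<le> c1 * (norm_X m1 m2 h (?div (pstar - p)))\<^sup>2 + c2 * (norm_Y m1 m2 h (pstar - p))\<^sup>2"
    using stable pstar p unfolding stable_decomposition_def by metis
  define D where "D = (nrm (?div pstar - ?div p))\<^sup>2"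
  have div_diff: "?div (pstar - p) = ?div pstar - ?div p"
    using div_h_add_scale[OF CY[OF pstar] CY[OF p], of "-1"] by simp
  have div_t: "(\<Sum>k\<in>?K. ?div (t k)) = ?div pstar - ?div p"
    using div_h_sum[OF K, of t] tW WY unfolding div_diff[symmetric] t_sum by auto
  have "(\<Sum>k\<in>?K. (nrm (?div (t k)))\<^sup>2) = (\<Sum>k=1..N. (norm_X m1 m2 h (?div (t k)))\<^sup>2)"
    using div_h(1)[OF WY] tW by (intro sum.cong) (auto simp: norm_X_eq_nrm)
  also have "\<dots> \<le> c1 * (norm_X m1 m2 h (?div (pstar - p)))\<^sup>2 + c2 * (norm_Y m1 m2 h (pstar - p))\<^sup>2"
    by (rule t_bound)
  also have "\<dots> \<le> c1 * D + c2 * (8 * ?V)"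
    using c norm_Y_diff_Cset[OF pstar p] div_h(1)[OF CY[OF p]] div_h(1)[OF CY[OF pstar]]
    unfolding D_def div_diff
    by (intro add_mono mult_left_mono) (simp_all add: norm_X_eq_nrm X_closed)
  finally have t_nrm: "(\<Sum>k\<in>?K. (nrm (?div (t k)))\<^sup>2) \<le> c1 * D + c2 * (8 * ?V)" .
  have E_add: "E (p + s) = conjugate (?div p + ?div s)" if "s \<in> Yh m1 m2 h" for s
    using that div_h_add_scale[OF CY[OF p] that, of 1] Yh_add[OF CY[OF p] that]
    by (simp add: E_def dual_energy_eq)
  have E_p: "E p = conjugate (?div p)" and E_pstar: "E pstar = conjugate (?div pstar)"
    using p pstar by (simp_all add: E_def dual_energy_eq CY)

  have "(\<Sum>k\<in>?K. E (p + r k) - E p) \<le> (\<Sum>k\<in>?K. conjugate (?div p + \<rho> *\<^sub>R ?div (t k)) - conjugate (?div p))"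
  proof (intro sum_mono)
    fix k assume k: "k \<in> ?K"
    have tY: "t k \<in> Yh m1 m2 h"
      using WY[OF k tW[OF k]] .
    \<comment> \<open>The competitor of \<open>r k\<close> is feasible because it lies on the
      segment between two members of \<open>Cset\<close>.\<close>
    have "p + \<rho> *\<^sub>R t k = (1 - \<rho>) *\<^sub>R p + \<rho> *\<^sub>R (p + t k)"
      by (simp add: algebra_simps)
    also have "\<dots> \<in> Cset m1 m2 h"
      using \<rho> by (intro Cset_convex p tC k) auto
    finally have "E (p + r k) \<le> E (p + \<rho> *\<^sub>R t k)"
      by (intro r_min k W_scale tW)
    also have "\<dots> = conjugate (?div p + \<rho> *\<^sub>R ?div (t k))"
      using div_h_add_scale[OF CY[OF p] tY, of \<rho>] Yh_add[OF CY[OF p] Yh_scale[OF tY, of \<rho>]]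
      by (simp add: E_def dual_energy_eq)
    finally show "E (p + r k) - E p \<le> conjugate (?div p + \<rho> *\<^sub>R ?div (t k)) - conjugate (?div p)"
      by (simp add: E_p)
  qed
  also have "\<dots> \<le> \<rho> * (E pstar - E p) - \<rho> / (2 * \<beta>) * D + \<rho>\<^sup>2 / (2 * \<alpha>) * (\<Sum>k\<in>?K. (nrm (?div (t k)))\<^sup>2)"
    unfolding E_p E_pstar D_def using \<rho> div_h(1) CY p pstar WY tW
    by (intro conjugate_local_sum div_t) auto
  also have "\<dots> \<le> \<rho> * (E pstar - E p) - \<rho> / (2 * \<beta>) * D + \<rho>\<^sup>2 / (2 * \<alpha>) * (c1 * D + c2 * (8 * ?V))"
    using \<alpha> by (intro add_left_mono mult_left_mono t_nrm) auto
  finally have local: "(\<Sum>k\<in>?K. E (p + r k) - E p)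
      \<le> \<rho> * (E pstar - E p) - \<rho> / (2 * \<beta>) * D + \<rho>\<^sup>2 / (2 * \<alpha>) * (c1 * D + c2 * (8 * ?V))" .
  have "\<alpha> * (\<Sum>k\<in>?K. E (p + r k) - E p)
      \<le> \<alpha> * (\<rho> * (E pstar - E p) - \<rho> / (2 * \<beta>) * D + \<rho>\<^sup>2 / (2 * \<alpha>) * (c1 * D + c2 * (8 * ?V)))"
    using \<alpha> by (intro mult_left_mono local) auto
  \<comment> \<open>Multiplication by \<alpha> turns 1/(2 \<beta>) into 1/(2 \<kappa>) and 1/(2
    \<alpha>) into 1/2, so 8 becomes 4.\<close>
  also have "\<dots> = - \<rho> * (\<alpha> * (E p - E pstar)) + \<rho> / 2 * (\<rho> * c1 - 1 / \<kappa>) * D + \<rho> * (4 * c2 * ?V * \<rho>)"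
    using \<alpha> \<beta> by (simp add: \<kappa>_def field_simps power2_eq_square)
  also have "\<dots> \<le> - \<rho> * (\<alpha> * (E p - E pstar)) + \<rho> * (4 * c2 * ?V * \<rho>)"
  proof -
    have "\<rho> / 2 * (\<rho> * c1 - 1 / \<kappa>) * D \<le> 0"
      using \<rho> by (intro mult_nonpos_nonneg mult_nonneg_nonpos) (auto simp: D_def)
    then show ?thesis by linarith
  qed
  finally have decrease: "\<alpha> * (\<Sum>k\<in>?K. E (p + r k) - E p)
      \<le> - \<rho> * (\<alpha> * (E p - E pstar)) + \<rho> * (4 * c2 * ?V * \<rho>)" .

  have rY: "r k \<in> Yh m1 m2 h" if "k \<in> ?K" for k
    using WY[OF that rW[OF that]] .
  have sum_rY: "(\<Sum>k\<in>?K. r k) \<in> Yh m1 m2 h" and div_r: "?div (\<Sum>k\<in>?K. r k) = (\<Sum>k\<in>?K. ?div (r k))"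
    using div_h_sum[OF K, of r] rY by auto
  have "E p' = conjugate (?div p + \<tau> *\<^sub>R (\<Sum>k\<in>?K. ?div (r k)))"
    unfolding E_def dual_energy_eq[OF CY[OF p']]
    unfolding p'_def div_h_add_scale[OF CY[OF p] sum_rY] div_r ..
  also have "\<dots> \<le> conjugate (?div p) + \<tau> * (\<Sum>k\<in>?K. conjugate (?div p + ?div (r k)) - conjugate (?div p))"
    using div_h(1) CY[OF p] rY \<tau> \<tau>N by (intro conjugate_average) auto
  also have "\<dots> = E p + \<tau> * (\<Sum>k\<in>?K. E (p + r k) - E p)"
    using E_add rY by (simp add: E_p)
  finally have "\<alpha> * (E p' - E pstar) \<le> \<alpha> * (E p + \<tau> * (\<Sum>k\<in>?K. E (p + r k) - E p) - E pstar)"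
    using \<alpha> by (intro mult_left_mono) auto
  also have "\<dots> = \<alpha> * (E p - E pstar) + \<tau> * (\<alpha> * (\<Sum>k\<in>?K. E (p + r k) - E p))"
    by (simp add: algebra_simps)
  also have "\<dots> \<le> \<alpha> * (E p - E pstar)
      + \<tau> * (- \<rho> * (\<alpha> * (E p - E pstar)) + \<rho> * (4 * c2 * ?V * \<rho>))"
    using \<tau> by (intro add_left_mono mult_left_mono decrease) auto
  finally show "\<alpha> * (E p' - E pstar) \<le> (1 - \<tau> * \<rho>) * (\<alpha> * (E p - E pstar))
      + \<tau> * \<rho> * (4 * c2 * ?V * \<rho>)"
    by (simp add: algebra_simps)
qed

end

theorem theorem3p5:
  fixes m1 m2 N :: nat
    and h \<alpha> \<beta> \<kappa> c1 c2 \<tau> :: real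
    and F :: "(point \<Rightarrow> real) \<Rightarrow> real"
    and F' :: "(point \<Rightarrow> real) \<Rightarrow> (point \<Rightarrow> real)"
    and W :: "nat \<Rightarrow> (point \<Rightarrow> point) set"
    and p :: "nat \<Rightarrow> point \<Rightarrow> point"
    and pstar :: "point \<Rightarrow> point"
    and \<zeta> :: "nat \<Rightarrow> real"
  assumes "m1 \<ge> 1" and "m2 \<ge> 1" and "h > 0"
    and "\<alpha> > 0" and "strongly_convex_X m1 m2 h \<alpha> F"
    and "\<And>u. u \<in> Xh m1 m2 h \<Longrightarrow> frechet_derivative_X m1 m2 h F u (F' u)"
    and "\<beta> > 0"
    and "\<And>u v. u \<in> Xh m1 m2 h \<Longrightarrow> v \<in> Xh m1 m2 h \<Longrightarrow>
           norm_X m1 m2 h (F' u - F' v) \<le> \<beta> * norm_X m1 m2 h (u - v)"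
    and "\<kappa> = \<beta> / \<alpha>"
    and "N \<ge> 1" and "space_decomposition m1 m2 h N W"
    and "c1 > 0" and "c2 \<ge> 0" and "stable_decomposition m1 m2 h N W c1 c2"
    and "0 < \<tau>" and "\<tau> \<le> 1 / real N"
    and "p 0 \<in> Cset m1 m2 h" and "additive_schwarz m1 m2 h F N W \<tau> p"
    and "is_arg_min (dual_energy m1 m2 h F) (\<lambda>q. q \<in> Cset m1 m2 h) pstar"
    and "\<And>n. \<zeta> n = \<alpha> * (dual_energy m1 m2 h F (p n) - dual_energy m1 m2 h F pstar)"
  shows "\<forall>n. \<zeta> n \<le>
      (1 - \<tau> / (\<kappa>\<^sup>2 * (sqrt c1 + sqrt (c1 + 1 / \<kappa>\<^sup>2))\<^sup>2)) ^ n
        * (\<zeta> 0 - 4 * c2 * measure lebesgue (Omega m1 m2 h) / (\<kappa> * sqrt (c1 * (c1 + 1 / \<kappa>\<^sup>2))))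
      + 4 * c2 * measure lebesgue (Omega m1 m2 h) / (\<kappa> * sqrt (c1 * (c1 + 1 / \<kappa>\<^sup>2)))"
proof -
  interpret mesh m1 m2 h
    by unfold_locales fact
  have diff: "u - v \<in> Xh m1 m2 h" if "u \<in> Xh m1 m2 h" "v \<in> Xh m1 m2 h" for u v
    using that Xh_subspace by (simp add: subspace_diff)
  have F'_Xh: "F' u \<in> Xh m1 m2 h" if "u \<in> Xh m1 m2 h" for u
    using assms(6)[OF that] by (simp add: frechet_derivative_X_def)
  \<comment> \<open>\<open>norm_X\<close> and \<open>inner_X\<close> are replaced by
    \<open>nrm\<close> and \<open>ip\<close> only on \<open>Xh\<close>, so each transfer first
    places the differences and gradients in \<open>Xh\<close>.\<close>
  interpret dual_mesh m1 m2 h F F' \<alpha> \<beta>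
  proof unfold_locales
    show "subspace (Xh m1 m2 h)"
      by (rule Xh_subspace)
    show "convex_on (Xh m1 m2 h) (\<lambda>u. F u - \<alpha> / 2 * (nrm u)\<^sup>2)"
      using \<open>strongly_convex_X m1 m2 h \<alpha> F\<close> unfolding strongly_convex_X_def convex_on_def
      using Xh_subspace
      by (auto simp: norm_X_eq_nrm subspace_add subspace_scale)
    show "\<exists>\<delta>>0. \<forall>v\<in>Xh m1 m2 h. nrm (v - u) < \<delta> \<longrightarrow>
        \<bar>F v - F u - ip (F' u) (v - u)\<bar> \<le> \<epsilon> * nrm (v - u)"
      if u: "u \<in> Xh m1 m2 h" and \<epsilon>: "\<epsilon> > 0" for u \<epsilon>
    proof -
      obtain \<delta> where "\<delta> > 0" and "\<forall>v \<in> Xh m1 m2 h. norm_X m1 m2 h (v - u) < \<delta> \<longrightarrow>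
          \<bar>F v - F u - inner_X m1 m2 h (F' u) (v - u)\<bar> \<le> \<epsilon> * norm_X m1 m2 h (v - u)"
        using assms(6)[OF u] \<epsilon> unfolding frechet_derivative_X_def by blast
      then show ?thesis
        using diff u F'_Xh by (intro exI[of _ \<delta>]) (simp add: norm_X_eq_nrm inner_X_eq_ip)
    qed
    show "nrm (F' u - F' v) \<le> \<beta> * nrm (u - v)" if "u \<in> Xh m1 m2 h" "v \<in> Xh m1 m2 h" for u v
      using assms(8)[OF that] that diff F'_Xh by (simp add: norm_X_eq_nrm)
  qed (use F'_Xh \<open>\<alpha> > 0\<close> \<open>\<beta> > 0\<close> in auto)
  define \<rho> where "\<rho> = 1 / (\<kappa>\<^sup>2 * (sqrt c1 + sqrt (c1 + 1 / \<kappa>\<^sup>2))\<^sup>2)"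
  define Q where "Q = \<kappa> * sqrt (c1 * (c1 + 1 / \<kappa>\<^sup>2))"
  let ?V = "measure lebesgue (Omega m1 m2 h)"
  have "\<kappa> \<ge> 1"
    using alpha_le_beta_mesh \<open>\<kappa> = \<beta> / \<alpha>\<close> \<open>\<alpha> > 0\<close> assms(1,2) by simp
  note \<rho> = schwarz_rate[OF this \<open>c1 > 0\<close>, folded \<rho>_def Q_def]
  have pstar: "pstar \<in> Cset m1 m2 h"
    using assms(19) by (simp add: is_arg_min_def)
  have step: "p (Suc n) \<in> Cset m1 m2 h \<and>
      \<zeta> (Suc n) \<le> (1 - \<tau> * \<rho>) * \<zeta> n + \<tau> * \<rho> * (4 * c2 * ?V * \<rho>)"
    if pn: "p n \<in> Cset m1 m2 h" for n
  proof -
    obtain r where r: "\<And>k. k \<in> {1..N} \<Longrightarrow> is_arg_min (\<lambda>s. dual_energy m1 m2 h F (p n + s))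
        (\<lambda>s. s \<in> W k \<and> p n + s \<in> Cset m1 m2 h) (r k)"
      and eq: "p (Suc n) = p n + \<tau> *\<^sub>R (\<Sum>k=1..N. r k)"
      using \<open>additive_schwarz m1 m2 h F N W \<tau> p\<close> unfolding additive_schwarz_def by blast
    show ?thesis
      unfolding assms(20) eq
      using additive_schwarz_step[OF assms(1,2,9-16) pn pstar r \<rho>(1-3)] by blast
  qed
  have "p n \<in> Cset m1 m2 h" for n
    by (induction n) (use assms(17) step in auto)
  \<comment> \<open>One step yields the limiting value \<open>4 * c2 * ?V * \<rho>\<close>; here it
    is enlarged to the one in the claim.\<close>
  moreover have "4 * c2 * ?V * \<rho> \<le> 4 * c2 * ?V / Q"
    using mult_left_mono[OF \<rho>(4), of "4 * c2 * ?V"] \<open>c2 \<ge> 0\<close> by simp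
  ultimately have "\<zeta> (Suc n) \<le> (1 - \<tau> * \<rho>) * \<zeta> n + \<tau> * \<rho> * (4 * c2 * ?V / Q)" for n
    using step[of n] \<rho>(1) \<open>\<tau> > 0\<close> mult_left_mono[of "4 * c2 * ?V * \<rho>" "4 * c2 * ?V / Q" "\<tau> * \<rho>"]
    by fastforce
  \<comment> \<open>This keeps the contraction factor nonnegative, as iterating the recursion
    requires.\<close>
  moreover have "\<tau> * \<rho> \<le> 1"
  proof -
    have "1 / real N \<le> 1"
      using \<open>N \<ge> 1\<close> by simp
    then have "\<tau> \<le> 1"
      using \<open>\<tau> \<le> 1 / real N\<close> by linarith
    then show ?thesis
      using mult_mono[of \<tau> 1 \<rho> 1] \<rho> by simp
  qed
  ultimately have "\<zeta> n \<le> (1 - \<tau> * \<rho>) ^ n * (\<zeta> 0 - 4 * c2 * ?V / Q) + 4 * c2 * ?V / Q" for n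
    by (rule affine_recursion_bound)
  then show ?thesis
    by (simp add: \<rho>_def Q_def)
qed

end
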